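(* Suppose the local functions $f_1,\dots,f_n$ satisfy the smoothness assumption (constant $L_f$), the bounded variance assumption (constant $\sigma$) and the bounded heterogeneity assumption (constants $\varsigma_x,\varsigma_y$), and $f=\frac1n\sum_i f_i$ satisfies the $\mu$-PL condition in $\mathbf y$; let $\kappa=L_f/\mu$ and $\Phi(\mathbf x)=\max_{\mathbf y}f(\mathbf x,\mathbf y)$. Then, to reach an $\epsilon$-accurate point, i.e. an output $\bar{\mathbf x}_T$ with $\mathbb E\|\nabla\Phi(\bar{\mathbf x}_T)\|\le\epsilon$, assuming $T\ge\Theta(n^3)$, the stochastic gradient complexity of Local SGDA (with suitably chosen $\eta_x,\eta_y,\tau$) is $T=\mathcal O(\kappa^4/(n\epsilon^4))$, and the number of communication rounds required for the same is $T/\tau=\mathcal O(\kappa^3/\epsilon^3)$.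
   Context: Setting: $n\ge1$ clients; client $i$ has a local function $f_i:\mathbb R^{d_1}\times\mathbb R^{d_2}\to\mathbb R$, $f_i(\mathbf x,\mathbf y)=\mathbb E_{\xi_i\sim\mathcal D_i}[L(\mathbf x,\mathbf y;\xi_i)]$. The problem is $\min_{\mathbf x}\max_{\mathbf y} f(\mathbf x,\mathbf y)$ with $f=\frac1n\sum_i f_i$. $\|\cdot\|$ is the Euclidean norm; $\nabla f_i(\mathbf x,\mathbf y;\xi^i)$ denotes a stochastic gradient at client $i$, with components $\nabla_{\mathbf x},\nabla_{\mathbf y}$. Smoothness: each $f_i$ is differentiable and, for some $L_f>0$, $\|\nabla f_i(\mathbf x,\mathbf y)-\nabla f_i(\mathbf x',\mathbf y')\|\le L_f\|(\mathbf x,\mathbf y)-(\mathbf x',\mathbf y')\|$ for all $i$ and all arguments. Bounded variance: for some $\sigma>0$, for all $i,\mathbf x,\mathbf y$: $\mathbb E_{\xi^i}[\nabla f_i(\mathbf x,\mathbf y;\xi^i)]=\nabla f_i(\mathbf x,\mathbf y)$ and $\mathbb E_{\xi^i}\|\nabla f_i(\mathbf x,\mathbf y;\xi^i)-\nabla f_i(\mathbf x,\mathbf y)\|^2\le\sigma^2$; samples are independent across clients and drawn afresh at each iteration. Bounded heterogeneity: $\varsigma_x^2=\sup_{\mathbf x,\mathbf y}\frac1n\sum_i\|\nabla_{\mathbf x} f_i-\nabla_{\mathbf x} f\|^2$ and $\varsigma_y^2=\sup_{\mathbf x,\mathbf y}\frac1n\sum_i\|\nabla_{\mathbf y} f_i-\nabla_{\mathbf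 y} f\|^2$ are finite. $\mu$-PL condition in $\mathbf y$ ($\mu>0$): for each fixed $\mathbf x$, $\max_{\mathbf y'}f(\mathbf x,\mathbf y')$ has a nonempty solution set, and $\|\nabla_{\mathbf y} f(\mathbf x,\mathbf y)\|^2\ge2\mu(\max_{\mathbf y'}f(\mathbf x,\mathbf y')-f(\mathbf x,\mathbf y))$ for all $\mathbf y$. Local SGDA (inputs $\mathbf x_0,\mathbf y_0$, $\eta_x,\eta_y>0$, integers $\tau,T\ge1$): $\mathbf x_0^i=\mathbf x_0$, $\mathbf y_0^i=\mathbf y_0$ for all $i$. For $t=0,\dots,T-1$ each client samples $\xi_t^i$ and sets $\mathbf x^i_{t+1}=\mathbf x^i_t-\eta_x\nabla_{\mathbf x} f_i(\mathbf x^i_t,\mathbf y^i_t;\xi^i_t)$, $\mathbf y^i_{t+1}=\mathbf y^i_t+\eta_y\nabla_{\mathbf y} f_i(\mathbf x^i_t,\mathbf y^i_t;\xi^i_t)$; if $\tau$ divides $t+1$ all $\mathbf x^i_{t+1}$ (resp. $\mathbf y^i_{t+1}$) are replaced by their average over clients. With $\mathbf x_t=\frac1n\sum_i\mathbf x^i_t$, the output $\bar{\mathbf x}_T$ is uniform on $\{\mathbf x_0,\dots,\mathbf x_{T-1}\}$. Stochastic gradient complexity: the total number of gradients computed by a single client, which is of order $T$. Communication rounds: the number of times clients communicate their local models to the server, i.e. $\lceil T/\tau\rceil$. The constants hidden in $\mathcal O(\cdot)$ do not depend on $\epsilon,n,\kappa$ (they may depend on $L_f,\sigma,\varsigma_x,\varsigma_y$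 and the initialization). The complexity claim means: there are choices of $\eta_x,\eta_y,\tau,T$ with $T$ and $T/\tau$ of the stated orders for which the output is $\epsilon$-accurate.
   Formalization: Φ is additionally assumed bounded below, with constants depending on bounds for Φ(x_0)−inf Φ and Φ(x_0)−f(x_0,y_0), and κ≥1 is assumed; without these the claim fails, e.g. for f=⟨a,x⟩−μ|y|²/2, or for f constant in y with tiny κ. *)

theory Defs
  imports "HOL-Probability.Probability"
begin

definition gradient :: "('a::real_inner \<Rightarrow> real) \<Rightarrow> 'a \<Rightarrow> 'a" where
  "gradient f z = (THE g. GDERIV f z :> g)"

text \<open>
  Clients are indexed by \<open>i < n\<close>. A point is a pair \<open>z = (x, y)\<close> with the Euclidean norm of the
  product, so \<open>fst (gradient f z)\<close> and \<open>snd (gradient f z)\<close> are the partial gradients of \<open>f\<close> in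
  \<open>x\<close> and in \<open>y\<close>.
\<close>

definition local_loss :: "(nat \<Rightarrow> 's measure) \<Rightarrow> ('z \<Rightarrow> 's \<Rightarrow> real) \<Rightarrow> nat \<Rightarrow> 'z \<Rightarrow> real" where
  "local_loss D L i z = (LINT s|D i. L z s)"

definition well_defined_loss :: "nat \<Rightarrow> (nat \<Rightarrow> 's measure) \<Rightarrow> ('z \<Rightarrow> 's \<Rightarrow> real) \<Rightarrow> bool" where
  "well_defined_loss n D L \<longleftrightarrow> (\<forall>i<n. prob_space (D i) \<and> (\<forall>z. integrable (D i) (L z)))"

definition global_loss :: "nat \<Rightarrow> (nat \<Rightarrow> 'z \<Rightarrow> real) \<Rightarrow> 'z \<Rightarrow> real" where
  "global_loss n f z = (\<Sum>i<n. f i z) / real n"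

definition smooth_clients :: "nat \<Rightarrow> (nat \<Rightarrow> 'z::euclidean_space \<Rightarrow> real) \<Rightarrow> real \<Rightarrow> bool" where
  "smooth_clients n f L\<^sub>f \<longleftrightarrow> (\<forall>i<n.
     (\<forall>z. f i differentiable (at z)) \<and>
     (\<forall>z z'. norm (gradient (f i) z - gradient (f i) z') \<le> L\<^sub>f * norm (z - z')))"

text \<open>
  \<open>G i z s\<close> is the stochastic gradient of client \<open>i\<close> at the point \<open>z\<close> for the sample \<open>s\<close>. The
  integrability conditions are explicit because the Bochner integral of a non-integrable
  function is \<open>0\<close>.
\<close>

definition bounded_variance ::
  "nat \<Rightarrow> (nat \<Rightarrow> 's measure) \<Rightarrow> (nat \<Rightarrow> 'z::euclidean_space \<Rightarrow> real) \<Rightarrow> (nat \<Rightarrow> 'z \<Rightarrow> 's \<Rightarrow> 'z) \<Rightarrow> real \<Rightarrow> bool"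
where
  "bounded_variance n D f G \<sigma> \<longleftrightarrow> (\<forall>i<n.
     (\<lambda>(z, s). G i z s) \<in> borel_measurable (borel \<Otimes>\<^sub>M D i) \<and>
     (\<forall>z. integrable (D i) (G i z) \<and>
          (LINT s|D i. G i z s) = gradient (f i) z \<and>
          integrable (D i) (\<lambda>s. (norm (G i z s - gradient (f i) z))\<^sup>2) \<and>
          (LINT s|D i. (norm (G i z s - gradient (f i) z))\<^sup>2) \<le> \<sigma>\<^sup>2))"

text \<open>The parameter \<open>p\<close> is \<open>fst\<close> for the \<open>x\<close>-component and \<open>snd\<close> for the \<open>y\<close>-component.\<close>

definition heterogeneity ::
  "nat \<Rightarrow> (nat \<Rightarrow> 'z::euclidean_space \<Rightarrow> real) \<Rightarrow> ('z \<Rightarrow> 'c::euclidean_space) \<Rightarrow> 'z \<Rightarrow> real" where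
  "heterogeneity n f p z =
     (\<Sum>i<n. (norm (p (gradient (f i) z) - p (gradient (global_loss n f) z)))\<^sup>2) / real n"

definition bounded_heterogeneity ::
  "nat \<Rightarrow> (nat \<Rightarrow> 'a::euclidean_space \<times> 'b::euclidean_space \<Rightarrow> real) \<Rightarrow> real \<Rightarrow> real \<Rightarrow> bool" where
  "bounded_heterogeneity n f \<zeta>\<^sub>x \<zeta>\<^sub>y \<longleftrightarrow>
     bdd_above (range (heterogeneity n f fst)) \<and> \<zeta>\<^sub>x\<^sup>2 = (SUP z. heterogeneity n f fst z) \<and>
     bdd_above (range (heterogeneity n f snd)) \<and> \<zeta>\<^sub>y\<^sup>2 = (SUP z. heterogeneity n f snd z)"

text \<open>\<open>\<Phi>(x) = max\<^sub>y f(x, y)\<close>; that the supremum is attained is part of \<open>PL_in_y\<close>.\<close>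

definition primal :: "('a \<times> 'b \<Rightarrow> real) \<Rightarrow> 'a \<Rightarrow> real" where
  "primal f x = (SUP y. f (x, y))"

definition PL_in_y :: "('a::euclidean_space \<times> 'b::euclidean_space \<Rightarrow> real) \<Rightarrow> real \<Rightarrow> bool" where
  "PL_in_y f \<mu> \<longleftrightarrow> (\<forall>x.
     (\<exists>y\<^sub>0. \<forall>y. f (x, y) \<le> f (x, y\<^sub>0)) \<and>
     (\<forall>y. (norm (snd (gradient f (x, y))))\<^sup>2 \<ge> 2 * \<mu> * (primal f x - f (x, y))))"

text \<open>\<open>\<xi> t i\<close> is the sample drawn by client \<open>i\<close> at iteration \<open>t\<close>.\<close>

definition independent_samples ::
  "nat \<Rightarrow> (nat \<Rightarrow> 's measure) \<Rightarrow> 'w measure \<Rightarrow> (nat \<Rightarrow> nat \<Rightarrow> 'w \<Rightarrow> 's) \<Rightarrow> bool" where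
  "independent_samples n D M \<xi> \<longleftrightarrow>
     prob_space M \<and>
     (\<forall>t. \<forall>i<n. \<xi> t i \<in> measurable M (D i) \<and> distr M (D i) (\<xi> t i) = D i) \<and>
     prob_space.indep_vars M (\<lambda>(t, i). D i) (\<lambda>(t, i). \<xi> t i) (UNIV \<times> {..<n})"

text \<open>
  \<open>local_sgda n G \<eta>\<^sub>x \<eta>\<^sub>y \<tau> x\<^sub>0 y\<^sub>0 s t i\<close> is the pair of local iterates of client \<open>i\<close> after \<open>t\<close>
  iterations when client \<open>j\<close> uses the sample \<open>s k j\<close> in iteration \<open>k\<close>.
\<close>

primrec local_sgda ::
  "nat \<Rightarrow> (nat \<Rightarrow> 'a::euclidean_space \<times> 'b::euclidean_space \<Rightarrow> 's \<Rightarrow> 'a \<times> 'b) \<Rightarrow> real \<Rightarrow> real \<Rightarrow> nat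
    \<Rightarrow> 'a \<Rightarrow> 'b \<Rightarrow> (nat \<Rightarrow> nat \<Rightarrow> 's) \<Rightarrow> nat \<Rightarrow> nat \<Rightarrow> 'a \<times> 'b" where
  "local_sgda n G \<eta>\<^sub>x \<eta>\<^sub>y \<tau> x\<^sub>0 y\<^sub>0 s 0 = (\<lambda>i. (x\<^sub>0, y\<^sub>0))"
| "local_sgda n G \<eta>\<^sub>x \<eta>\<^sub>y \<tau> x\<^sub>0 y\<^sub>0 s (Suc t) =
     (let z = local_sgda n G \<eta>\<^sub>x \<eta>\<^sub>y \<tau> x\<^sub>0 y\<^sub>0 s t;
          z' = (\<lambda>i. (fst (z i) - \<eta>\<^sub>x *\<^sub>R fst (G i (z i) (s t i)),
                     snd (z i) + \<eta>\<^sub>y *\<^sub>R snd (G i (z i) (s t i))))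
      in if \<tau> dvd Suc t then (\<lambda>i. (1 / real n) *\<^sub>R (\<Sum>j<n. z' j)) else z')"

definition avg_iterate ::
  "nat \<Rightarrow> (nat \<Rightarrow> 'a::euclidean_space \<times> 'b::euclidean_space \<Rightarrow> 's \<Rightarrow> 'a \<times> 'b) \<Rightarrow> real \<Rightarrow> real \<Rightarrow> nat
    \<Rightarrow> 'a \<Rightarrow> 'b \<Rightarrow> (nat \<Rightarrow> nat \<Rightarrow> 's) \<Rightarrow> nat \<Rightarrow> 'a" where
  "avg_iterate n G \<eta>\<^sub>x \<eta>\<^sub>y \<tau> x\<^sub>0 y\<^sub>0 s t =
     (1 / real n) *\<^sub>R (\<Sum>i<n. fst (local_sgda n G \<eta>\<^sub>x \<eta>\<^sub>y \<tau> x\<^sub>0 y\<^sub>0 s t i))"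

text \<open>
  The output is \<open>X t \<omega>\<close>, where \<open>t\<close> is uniform on \<open>{0, \<dots>, T - 1}\<close> and independent of the
  sampling outcome \<open>\<omega>\<close>. Differentiability and integrability make the expected gradient norm
  meaningful: otherwise the gradient would be arbitrary and the integral \<open>0\<close>.
\<close>

definition expected_stationary ::
  "('a::euclidean_space \<Rightarrow> real) \<Rightarrow> 'w measure \<Rightarrow> (nat \<Rightarrow> 'w \<Rightarrow> 'a) \<Rightarrow> nat \<Rightarrow> real \<Rightarrow> bool" where
  "expected_stationary \<Phi> M X T \<epsilon> \<longleftrightarrow>
     (\<forall>x. \<Phi> differentiable (at x)) \<and>
     (let P = M \<Otimes>\<^sub>M measure_pmf (pmf_of_set {..<T}) in
        integrable P (\<lambda>(\<omega>, t). norm (gradient \<Phi> (X t \<omega>))) \<and>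
        (LINT (\<omega>, t)|P. norm (gradient \<Phi> (X t \<omega>))) \<le> \<epsilon>)"

definition comm_rounds :: "nat \<Rightarrow> nat \<Rightarrow> int" where
  "comm_rounds T \<tau> = \<lceil>real T / real \<tau>\<rceil>"

end

theory Submission
  imports Defs
begin

text \<open>
  Write \<open>V = \<Phi> + (\<Phi> - f) / 4\<close>. Along the averaged iterates, with \<open>\<eta>\<^sub>x = \<eta>\<^sub>y / (48 \<kappa>\<^sup>2)\<close>, one step decreases
  \<open>V\<close> in expectation by \<open>\<eta>\<^sub>x / 2 \<cdot> \<parallel>\<nabla>\<Phi>\<parallel>\<^sup>2\<close>, up to the variance \<open>\<sigma>\<^sup>2 / n\<close> of the averaged noise and the squared
  deviation of the clients from their average. Smoothness of \<open>\<Phi>\<close> and the estimate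
  \<open>\<parallel>\<nabla>\<Phi>(x) - \<nabla>\<^sub>x f(x, y)\<parallel>\<^sup>2 \<le> 10 L \<kappa> (\<Phi>(x) - f(x, y))\<close> follow directly from the PL inequality applied at a
  perturbed \<open>x\<close>, without quadratic growth. The deviation is at most
  \<open>6 \<tau>\<^sup>2 \<eta>\<^sub>y\<^sup>2 (\<sigma>\<^sup>2 + \<zeta>\<^sub>x\<^sup>2 + \<zeta>\<^sub>y\<^sup>2)\<close>. With \<open>A = \<kappa> / \<epsilon>\<close> the choices \<open>\<eta>\<^sub>y = h n / A\<^sup>2\<close>, \<open>\<tau> = \<lceil>A / n\<rceil>\<close> and
  \<open>T = \<lceil>K A\<^sup>4 / n\<rceil>\<close>, for a small constant \<open>h\<close> and a large constant \<open>K\<close>, make the average of \<open>\<parallel>\<nabla>\<Phi>\<parallel>\<^sup>2\<close> at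
  most \<open>\<epsilon>\<^sup>2\<close>.
\<close>

text \<open>Maximisers in \<open>y\<close> need not be unique, so no smooth maximiser map is
  available; everything about \<open>\<Phi>\<close> is extracted from two-sided quadratic bounds.
  The ratio of the step sizes comes from one term: replacing \<open>\<nabla>\<Phi>\<close> by the
  partial gradient costs \<open>\<eta>\<^sub>x L \<kappa> (\<Phi> - f)\<close> up to a factor, while
  the ascent in \<open>y\<close> gains only \<open>\<eta>\<^sub>y \<mu> (\<Phi> - f)\<close>. With
  that ratio \<open>\<eta>\<^sub>x \<epsilon>\<^sup>2\<close> is a multiple of
  \<open>\<eta>\<^sub>y / A\<^sup>2\<close>, so \<open>\<kappa>\<close> and
  \<open>\<epsilon>\<close> enter only through \<open>A\<close>. Per step, the averaged noise costs
  \<open>\<eta>\<^sub>y\<^sup>2 / n\<close>, which allows \<open>\<eta>\<^sub>y\<close> of order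
  \<open>n / A\<^sup>2\<close>; the deviation costs
  \<open>\<tau>\<^sup>2 \<eta>\<^sub>y\<^sup>3\<close>, which allows
  \<open>\<tau> \<eta>\<^sub>y\<close> of order \<open>1 / A\<close>; the initial value of
  \<open>V\<close> is paid once \<open>T \<eta>\<^sub>y / A\<^sup>2\<close> is large. The assumption
  relating \<open>T\<close> to \<open>n\<^sup>3\<close> says that \<open>A / n\<close> is bounded
  below. Hence rounding \<open>\<tau>\<close> up costs a constant factor and
  \<open>\<eta>\<^sub>y\<close> stays bounded. All constants are fixed before \<open>n\<close>,
  \<open>\<mu>\<close>, \<open>\<epsilon>\<close> and the instance, which is why the initial gaps
  enter as given bounds.\<close>

section \<open>Norm inequalities\<close>

lemma zero_le_mult_pos2: "0 \<le> a * b \<Longrightarrow> 0 < b \<Longrightarrow> 0 \<le> (a::real)"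
  by (simp add: zero_le_mult_iff)

lemma norm_add_square_le: "(norm (u + w))\<^sup>2 \<le> 2 * (norm u)\<^sup>2 + 2 * (norm (w::'c::real_inner))\<^sup>2"
  using zero_le_power2[of "norm (u - w)"]
  by (simp add: power2_norm_eq_inner algebra_simps inner_commute)

lemma norm_sum_square_le:
  fixes a :: "'i \<Rightarrow> 'c::real_normed_vector"
  shows "(norm (\<Sum>i\<in>I. a i))\<^sup>2 \<le> real (card I) * (\<Sum>i\<in>I. (norm (a i))\<^sup>2)"
proof -
  have "(norm (\<Sum>i\<in>I. a i))\<^sup>2 \<le> (\<Sum>i\<in>I. norm (a i))\<^sup>2"
    by (intro power_mono norm_sum) auto
  also have "\<dots> \<le> real (card I) * (\<Sum>i\<in>I. (norm (a i))\<^sup>2)"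
    using sum_squared_le_sum_of_squares[of "\<lambda>i. norm (a i)" I] by (simp add: mult.commute)
  finally show ?thesis .
qed

text \<open>The cross terms vanish because deviations from the mean sum to zero. In
  \<open>dev_Suc\<close> this replaces the mean stochastic gradient by
  \<open>F (zbar t \<omega>)\<close>, relative to which noise, drift and heterogeneity
  separate.\<close>

lemma sum_norm_sub_mean_le:
  fixes v :: "nat \<Rightarrow> 'c::real_inner"
  assumes "n \<ge> 1"
  shows "(\<Sum>i<n. (norm (v i - (1 / real n) *\<^sub>R (\<Sum>j<n. v j)))\<^sup>2) \<le> (\<Sum>i<n. (norm (v i - c))\<^sup>2)"
proof -
  define m where "m = (1 / real n) *\<^sub>R (\<Sum>j<n. v j)"
  have s: "(\<Sum>i<n. v i) = real n *\<^sub>R m" using assms by (simp add: m_def)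
  have "(norm (v i - c))\<^sup>2 = (norm (v i - m))\<^sup>2 + 2 * inner (v i - m) (m - c) + (norm (m - c))\<^sup>2" for i
    by (simp add: power2_norm_eq_inner algebra_simps inner_commute)
  then have "(\<Sum>i<n. (norm (v i - c))\<^sup>2) = (\<Sum>i<n. (norm (v i - m))\<^sup>2)
      + 2 * inner (\<Sum>i<n. v i - m) (m - c) + real n * (norm (m - c))\<^sup>2"
    by (simp add: sum.distrib sum_distrib_left inner_sum_left)
  moreover have "(\<Sum>i<n. v i - m) = 0" by (simp add: sum_subtractf s)
      (simp add: sum_constant_scaleR)
  ultimately show ?thesis by (simp add: m_def)
qed

lemma norm_add3_square_le:
  "(norm (a + b + c))\<^sup>2 \<le> 3 * ((norm a)\<^sup>2 + (norm b)\<^sup>2 + (norm (c::'c::real_inner))\<^sup>2)"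
proof -
  have "0 \<le> (norm (a - b))\<^sup>2 + (norm (b - c))\<^sup>2 + (norm (a - c))\<^sup>2" by simp
  then show ?thesis by (simp add: power2_norm_eq_inner algebra_simps inner_commute)
qed

text \<open>Young's inequality, from \<open>(norm (a - r *\<^sub>R b))\<^sup>2 / r \<ge> 0\<close>.
  With a fixed weight the deviation bound would double at each local step; the free \<open>r\<close>
  keeps its growth quadratic.\<close>

lemma norm_add_square_le_weighted:
  assumes "r > 0"
  shows "(norm (a + b))\<^sup>2 \<le> (1 + 1 / r) * (norm a)\<^sup>2 + (1 + r) * (norm (b::'c::real_inner))\<^sup>2"
proof -
  have "0 \<le> (norm (a - r *\<^sub>R b))\<^sup>2 / r" using assms by simp
  also have "\<dots> = (norm a)\<^sup>2 / r - 2 * inner a b + r * (norm b)\<^sup>2"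
    using assms by (simp add: power2_norm_eq_inner algebra_simps inner_commute
        add_divide_distrib diff_divide_distrib)
  also have "\<dots> = (1 + 1 / r) * (norm a)\<^sup>2 + (1 + r) * (norm b)\<^sup>2 - (norm (a + b))\<^sup>2"
    by (simp add: power2_norm_eq_inner algebra_simps inner_commute)
  finally show ?thesis by simp
qed

section \<open>Gradients and quadratic bounds\<close>

lemma GDERIV_unique: "GDERIV f z :> g \<Longrightarrow> GDERIV f z :> g' \<Longrightarrow> g = g'"
proof -
  assume "GDERIV f z :> g" "GDERIV f z :> g'"
  then have "(\<lambda>h. inner h g) = (\<lambda>h. inner h g')"
    unfolding gderiv_def by (rule has_derivative_unique)
  then have "inner (g - g') g = inner (g - g') g'" by meson
  then have "inner (g - g') (g - g') = 0" by (simp add: inner_diff_right)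
  then show ?thesis by simp
qed

lemma gradient_eqI: "GDERIV f z :> g \<Longrightarrow> gradient f z = g"
  unfolding gradient_def by (blast intro: GDERIV_unique)

text \<open>The Riesz representative of the derivative, assembled from its values on the basis,
  provides existence for the \<open>THE\<close> in \<open>gradient\<close>.\<close>

lemma GDERIV_gradient:
  fixes f :: "'z::euclidean_space \<Rightarrow> real"
  assumes "f differentiable (at z)"
  shows "GDERIV f z :> gradient f z"
proof -
  obtain f' where f': "(f has_derivative f') (at z)"
    using assms by (auto simp: differentiable_def)
  define g where "g = (\<Sum>b\<in>Basis. f' b *\<^sub>R b)"
  have lin: "linear f'"
    using f' by (rule has_derivative_linear)
  have "f' h = inner h g" for h
  proof -
    have "f' h = f' (\<Sum>b\<in>Basis. inner h b *\<^sub>R b)" by (simp add: euclidean_representation)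
    also have "\<dots> = (\<Sum>b\<in>Basis. inner h b * f' b)"
      using lin by (simp add: linear_sum linear_scale)
    also have "\<dots> = inner h g" by (simp add: g_def inner_sum_right mult.commute)
    finally show ?thesis .
  qed
  then have "f' = (\<lambda>h. inner h g)" by auto
  then have "GDERIV f z :> g" using f' by (simp add: gderiv_def)
  then show ?thesis by (simp add: gradient_eqI)
qed

text \<open>On the ball of radius \<open>norm (z' - z)\<close> about \<open>z\<close> the derivative
  differs from that at \<open>z\<close> by at most \<open>L\<close> times the radius; the mean value
  inequality contributes the second factor. Integration along the segment would give
  \<open>L / 2\<close>, which would only change constants.\<close>

lemma taylor_of_lipschitz_gradient:
  fixes f :: "'z::euclidean_space \<Rightarrow> real"
  assumes grad: "\<And>z. GDERIV f z :> F z"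
    and lip: "\<And>z z'. norm (F z - F z') \<le> L * norm (z - z')"
    and "L \<ge> 0"
  shows "\<bar>f z' - f z - inner (F z) (z' - z)\<bar> \<le> L * (norm (z' - z))\<^sup>2"
proof -
  have "norm (f z' - f z - inner (z' - z) (F z)) \<le> norm (z' - z) * (L * norm (z' - z))"
  proof (rule differentiable_bound_linearization[where S = "cball z (norm (z' - z))"
        and f' = "\<lambda>x h. inner h (F x)"])
    fix t :: real assume "t \<in> {0..1}"
    then show "z + t *\<^sub>R (z' - z) \<in> cball z (norm (z' - z))"
      by (auto simp: dist_norm mult_left_le_one_le)
  next
    fix x
    show "(f has_derivative (\<lambda>h. inner h (F x))) (at x within cball z (norm (z' - z)))"
      using grad[of x] unfolding gderiv_def by (rule has_derivative_at_withinI)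
    assume "x \<in> cball z (norm (z' - z))"
    then have "norm (x - z) \<le> norm (z' - z)" by (simp add: dist_norm norm_minus_commute)
    show "onorm ((\<lambda>h. inner h (F x)) - (\<lambda>h. inner h (F z))) \<le> L * norm (z' - z)"
    proof (rule onorm_le)
      fix h
      have "norm (inner h (F x) - inner h (F z)) \<le> norm h * norm (F x - F z)"
        by (metis Cauchy_Schwarz_ineq2 inner_diff_right real_norm_def)
      also have "\<dots> \<le> norm h * (L * norm (z' - z))"
        using lip[of x z] \<open>norm (x - z) \<le> _\<close> \<open>L \<ge> 0\<close>
        by (intro mult_left_mono) (auto intro: order_trans mult_left_mono)
      finally show "norm (((\<lambda>h. inner h (F x)) - (\<lambda>h. inner h (F z))) h) \<le> L * norm (z' - z) * norm h"
        by (simp add: mult.commute)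
    qed
  qed auto
  then show ?thesis by (simp add: power2_eq_square inner_commute mult_ac)
qed

text \<open>Three applications of the bound, to the points \<open>x\<close>, \<open>y\<close> and a third one at distance
  \<open>norm (y - x)\<close> from \<open>y\<close> in the direction \<open>g y - g x\<close>.\<close>
lemma lipschitz_of_quadratic_bound:
  fixes g :: "'z::euclidean_space \<Rightarrow> 'z"
  assumes q: "\<And>x x'. \<bar>\<phi> x' - \<phi> x - inner (g x) (x' - x)\<bar> \<le> B * (norm (x' - x))\<^sup>2"
  shows "norm (g y - g x) \<le> 6 * B * norm (y - x)"
proof (cases "x = y \<or> g y = g x")
  case True
  \<comment> \<open>The sign of \<open>B\<close> is not assumed: two distinct points force
    \<open>0 \<le> B\<close> through \<open>q\<close>, and for \<open>x = y\<close> the product is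
    0.\<close>
  have "0 \<le> B * norm (y - x)"
  proof (cases "x = y")
    case False
    have "0 \<le> B * (norm (y - x))\<^sup>2" using q[of y x] by linarith
    moreover have "0 < (norm (y - x))\<^sup>2" using False by simp
    ultimately have "0 \<le> B" by (rule zero_le_mult_pos2)
    then show ?thesis by simp
  qed auto
  with True show ?thesis by auto
next
  case False
  define v where "v = (norm (y - x) / norm (g y - g x)) *\<^sub>R (g y - g x)"
  have nv: "norm v = norm (y - x)" using False by (simp add: v_def)
  have "0 \<le> B * (norm (y - x))\<^sup>2" using q[of y x] by linarith
  moreover have "0 < (norm (y - x))\<^sup>2" using False by auto
  ultimately have B: "0 \<le> B" by (rule zero_le_mult_pos2)
  have "norm (y + v - x) \<le> 2 * norm (y - x)"
    using norm_triangle_ineq[of "y - x" v] nv by (simp add: algebra_simps)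
  then have *: "B * (norm (y + v - x))\<^sup>2 \<le> B * (4 * (norm (y - x))\<^sup>2)"
    using B power_mono[of "norm (y + v - x)" "2 * norm (y - x)" 2]
    by (intro mult_left_mono) (auto simp: power_mult_distrib)
  have inner_v: "inner (g y - g x) v = norm (g y - g x) * norm (y - x)"
    using False by (simp add: v_def dot_square_norm power2_eq_square)
  \<comment> \<open>The factor is \<open>4 + 1 + 1\<close>: the step from \<open>x\<close> to
    \<open>y + v\<close> has at most twice the length of \<open>y - x\<close>, the other two steps
    have exactly that length.\<close>
  have "inner (g y - g x) v \<le> 6 * (B * (norm (y - x))\<^sup>2)"
    using q[of "y + v" x] q[of "y + v" y] q[of y x] nv *
    by (simp add: inner_diff_left inner_diff_right inner_add_right abs_le_iff)
  then have "norm (y - x) * norm (g y - g x) \<le> norm (y - x) * (6 * B * norm (y - x))"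
    unfolding inner_v by (simp add: power2_eq_square mult_ac)
  then show ?thesis using False by auto
qed

lemma GDERIV_of_quadratic_bound:
  fixes \<phi> :: "'z::euclidean_space \<Rightarrow> real"
  assumes q: "\<And>x'. \<bar>\<phi> x' - \<phi> x - inner g (x' - x)\<bar> \<le> B * (norm (x' - x))\<^sup>2"
  shows "GDERIV \<phi> x :> g"
  unfolding gderiv_def has_derivative_within_alt
proof (intro conjI allI impI)
  show "bounded_linear (\<lambda>h. inner h g)" by (rule bounded_linear_inner_left)
  fix e :: real assume "e > 0"
  show "\<exists>d>0. \<forall>y\<in>UNIV. norm (y - x) < d \<longrightarrow> norm (\<phi> y - \<phi> x - inner (y - x) g) \<le> e * norm (y - x)"
  \<comment> \<open>Within this radius the quadratic remainder is at most
    \<open>e * norm (y - x)\<close>; the summand 1 keeps the denominator positive.\<close>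
  proof (intro exI[of _ "e / (\<bar>B\<bar> + 1)"] conjI ballI impI)
    show "0 < e / (\<bar>B\<bar> + 1)" using \<open>e > 0\<close> by simp
    fix y assume y: "norm (y - x) < e / (\<bar>B\<bar> + 1)"
    have "norm (\<phi> y - \<phi> x - inner (y - x) g) \<le> B * (norm (y - x))\<^sup>2"
      using q[of y] by (simp add: inner_commute)
    also have "\<dots> \<le> ((\<bar>B\<bar> + 1) * norm (y - x)) * norm (y - x)"
      unfolding power2_eq_square mult.assoc by (intro mult_right_mono) auto
    also have "\<dots> \<le> e * norm (y - x)"
      using y by (intro mult_right_mono) (auto simp: field_simps)
    finally show "norm (\<phi> y - \<phi> x - inner (y - x) g) \<le> e * norm (y - x)" .
  qed
qed

text \<open>Minimise the quadratic upper bound at \<open>h = - g / (2 B)\<close>.\<close>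
lemma norm_slope_le_of_nonneg:
  fixes g :: "'z::real_inner"
  assumes "\<And>h. 0 \<le> a + inner g h + B * (norm h)\<^sup>2" and "B > 0"
  shows "(norm g)\<^sup>2 \<le> 4 * B * a"
proof -
  have "0 \<le> a + inner g ((- 1 / (2 * B)) *\<^sub>R g) + B * (norm ((- 1 / (2 * B)) *\<^sub>R g))\<^sup>2"
    by (rule assms)
  also have "\<dots> = a - (norm g)\<^sup>2 / (4 * B)"
    using \<open>B > 0\<close> by (simp add: dot_square_norm power_mult_distrib power_divide)
      (simp add: field_simps power2_eq_square)
  finally show ?thesis using \<open>B > 0\<close> by (simp add: field_simps)
qed

section \<open>The primal function under the PL condition\<close>

text \<open>Descent in \<open>x\<close> and ascent in \<open>y\<close> form one linear map, so that
  a step commutes with averaging over the clients.\<close>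

definition sgda_step :: "real \<Rightarrow> real \<Rightarrow> 'a::real_inner \<times> 'b::real_inner \<Rightarrow> 'a \<times> 'b" where
  "sgda_step hx hy v = (- hx *\<^sub>R fst v, hy *\<^sub>R snd v)"

lemma bounded_linear_sgda_step:
  "bounded_linear (sgda_step hx hy :: 'a::real_inner \<times> 'b::real_inner \<Rightarrow> _)"
proof -
  have "bounded_linear (\<lambda>v :: 'a \<times> 'b. (- hx *\<^sub>R fst v, hy *\<^sub>R snd v))"
    by (intro bounded_linear_Pair bounded_linear_compose[OF bounded_linear_scaleR_right]
        bounded_linear_fst bounded_linear_snd)
  then show ?thesis by (simp add: sgda_step_def[abs_def])
qed

lemmas linear_sgda_step = bounded_linear.linear[OF bounded_linear_sgda_step]

lemmas sgda_step_simps = linear_add[OF linear_sgda_step] linear_diff[OF linear_sgda_step]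
  linear_scale[OF linear_sgda_step] linear_sum[OF linear_sgda_step]

lemma norm_sgda_step_le:
  assumes "0 \<le> hx" "hx \<le> hy"
  shows "norm (sgda_step hx hy v) \<le> hy * norm v"
proof -
  have "(hx * norm (fst v))\<^sup>2 \<le> (hy * norm (fst v))\<^sup>2"
    using assms by (intro power_mono mult_right_mono) auto
  then have "norm (sgda_step hx hy v) \<le> sqrt (hy\<^sup>2 * ((norm (fst v))\<^sup>2 + (norm (snd v))\<^sup>2))"
    by (simp add: sgda_step_def norm_Pair power_mult_distrib algebra_simps)
  also have "\<dots> = hy * norm v"
    using assms by (simp add: real_sqrt_mult norm_prod_def)
  finally show ?thesis .
qed

locale pl_problem =
  fixes f :: "'a::euclidean_space \<times> 'b::euclidean_space \<Rightarrow> real"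
    and F :: "'a \<times> 'b \<Rightarrow> 'a \<times> 'b" and L \<mu> :: real
  assumes mu_pos: "\<mu> > 0" and mu_le: "\<mu> \<le> L"
    and grad: "GDERIV f z :> F z"
    and lip: "norm (F z - F z') \<le> L * norm (z - z')"
    and pl: "PL_in_y f \<mu>"
    and F_eq: "F = gradient f"
begin

definition "\<Phi> = primal f"
definition "\<kappa> = L / \<mu>"

lemma L_pos: "L > 0" using mu_pos mu_le by simp

lemma kappa_ge_1: "\<kappa> \<ge> 1" using mu_pos mu_le by (simp add: \<kappa>_def)

lemma taylor: "\<bar>f z' - f z - inner (F z) (z' - z)\<bar> \<le> L * (norm (z' - z))\<^sup>2"
  using taylor_of_lipschitz_gradient[OF grad lip] L_pos by simp

lemma le_primal: "f (x, y) \<le> \<Phi> x"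
proof -
  obtain y0 where "\<forall>y. f (x, y) \<le> f (x, y0)" using pl unfolding PL_in_y_def by blast
  then have "bdd_above (range (\<lambda>y. f (x, y)))" by (auto simp: bdd_above_def)
  then show ?thesis unfolding \<Phi>_def primal_def by (auto intro: cSUP_upper)
qed

lemma primal_attained: obtains y where "\<Phi> x = f (x, y)"
proof -
  obtain y0 where y0: "\<forall>y. f (x, y) \<le> f (x, y0)" using pl unfolding PL_in_y_def by blast
  then have "\<Phi> x \<le> f (x, y0)" unfolding \<Phi>_def primal_def by (auto intro: cSUP_least)
  with le_primal[of x y0] that show thesis by (meson antisym)
qed

lemma pl_ineq: "2 * \<mu> * (\<Phi> x - f (x, y)) \<le> (norm (snd (F (x, y))))\<^sup>2"
  using pl unfolding PL_in_y_def \<Phi>_def F_eq by auto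

text \<open>At a maximiser the slack \<open>\<Phi> x - f (x, y)\<close> is 0, and with it the slope
  bound of \<open>norm_slope_le_of_nonneg\<close>.\<close>

lemma grad_y_at_max:
  assumes "\<Phi> x = f (x, y)" shows "snd (F (x, y)) = 0"
proof -
  have "0 \<le> 0 + inner (- snd (F (x, y))) h + L * (norm h)\<^sup>2" for h
    using taylor[of "(x, y + h)" "(x, y)"] le_primal[of x "y + h"] assms
    by (simp add: abs_le_iff norm_Pair inner_prod_def)
  then have "(norm (- snd (F (x, y))))\<^sup>2 \<le> 4 * L * 0"
    by (rule norm_slope_le_of_nonneg) (rule L_pos)
  then show ?thesis by simp
qed

text \<open>The envelope formula with an arbitrarily chosen maximiser. \<open>GDERIV_primal\<close>
  identifies \<open>g x\<close> as the gradient of \<open>\<Phi>\<close>, so the choice does not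
  affect the value.\<close>

definition "g x = fst (F (x, SOME y. \<Phi> x = f (x, y)))"

text \<open>A maximiser \<open>y\<close> for \<open>x\<close> is kept while \<open>x\<close> moves
  to \<open>x'\<close>. From below, \<open>\<Phi> x' \<ge> f (x', y)\<close> and Taylor suffice.
  From above, PL at \<open>(x', y)\<close> bounds \<open>\<Phi> x' - f (x', y)\<close> by the
  squared \<open>y\<close>-gradient there, which is at most \<open>L * norm (x' - x)\<close> because
  it vanishes at \<open>(x, y)\<close>. This adds \<open>L * \<kappa> / 2\<close> to the Taylor
  constant \<open>L \<le> L * \<kappa>\<close>.\<close>

lemma primal_lower: "\<Phi> x + inner (g x) (x' - x) - L * (norm (x' - x))\<^sup>2 \<le> \<Phi> x'"
  and primal_upper: "\<Phi> x' \<le> \<Phi> x + inner (g x) (x' - x) + 3 / 2 * (L * \<kappa>) * (norm (x' - x))\<^sup>2"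
proof -
  define y where "y = (SOME y. \<Phi> x = f (x, y))"
  have y: "\<Phi> x = f (x, y)"
    unfolding y_def by (rule someI_ex) (metis primal_attained)
  have t: "\<bar>f (x', y) - f (x, y) - inner (g x) (x' - x)\<bar> \<le> L * (norm (x' - x))\<^sup>2"
    using taylor[of "(x', y)" "(x, y)"] by (simp add: g_def y_def norm_Pair inner_prod_def)
  then show "\<Phi> x + inner (g x) (x' - x) - L * (norm (x' - x))\<^sup>2 \<le> \<Phi> x'"
    using le_primal[of x' y] y by (simp add: abs_le_iff)
  have "norm (snd (F (x', y))) \<le> norm (F (x', y) - F (x, y))"
    using grad_y_at_max[OF y] by (metis norm_snd_le snd_diff diff_zero prod.collapse)
  also have "\<dots> \<le> L * norm (x' - x)"
    using lip[of "(x', y)" "(x, y)"] by (simp add: norm_Pair)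
  finally have "(norm (snd (F (x', y))))\<^sup>2 \<le> L\<^sup>2 * (norm (x' - x))\<^sup>2"
    using power_mono[of _ _ 2] by (fastforce simp: power_mult_distrib)
  then have "2 * \<mu> * (\<Phi> x' - f (x', y)) \<le> L\<^sup>2 * (norm (x' - x))\<^sup>2"
    using pl_ineq[of x' y] by linarith
  then have "\<Phi> x' - f (x', y) \<le> L * \<kappa> / 2 * (norm (x' - x))\<^sup>2"
    using mu_pos by (simp add: \<kappa>_def field_simps power2_eq_square)
  moreover have "L * (norm (x' - x))\<^sup>2 \<le> L * \<kappa> * (norm (x' - x))\<^sup>2"
    using kappa_ge_1 L_pos by (intro mult_right_mono) auto
  ultimately show "\<Phi> x' \<le> \<Phi> x + inner (g x) (x' - x) + 3 / 2 * (L * \<kappa>) * (norm (x' - x))\<^sup>2"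
    using t y by (simp add: abs_le_iff)
qed

lemma primal_quadratic:
  "\<bar>\<Phi> x' - \<Phi> x - inner (g x) (x' - x)\<bar> \<le> 3 / 2 * (L * \<kappa>) * (norm (x' - x))\<^sup>2"
proof -
  have "L * 1 * (norm (x' - x))\<^sup>2 \<le> 3 / 2 * (L * \<kappa>) * (norm (x' - x))\<^sup>2"
    using kappa_ge_1 L_pos by (intro mult_right_mono) (auto intro: order_trans)
  then show ?thesis using primal_lower[of x x'] primal_upper[of x' x] by linarith
qed

lemma GDERIV_primal: "GDERIV \<Phi> x :> g x"
  by (rule GDERIV_of_quadratic_bound) (rule primal_quadratic)

lemma grad_primal_lipschitz: "norm (g x' - g x) \<le> 9 * (L * \<kappa>) * norm (x' - x)"
  using lipschitz_of_quadratic_bound[OF primal_quadratic, of x' x] by simp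

text \<open>\<open>\<Phi> - f (\<cdot>, y)\<close> is nonnegative with a quadratic upper bound, so its slope is controlled by
  its value.  This replaces the usual detour through the distance of \<open>y\<close> to the maximisers.\<close>
lemma grad_gap: "(norm (g x - fst (F (x, y))))\<^sup>2 \<le> 10 * (L * \<kappa>) * (\<Phi> x - f (x, y))"
proof -
  \<comment> \<open>\<open>5 / 2\<close> is \<open>3 / 2\<close> from the upper bound on
    \<open>\<Phi>\<close> plus 1 from Taylor for \<open>f\<close>, where
    \<open>L \<le> L * \<kappa>\<close>.\<close>
  have "0 \<le> (\<Phi> x - f (x, y)) + inner (g x - fst (F (x, y))) h + (5 / 2 * (L * \<kappa>)) * (norm h)\<^sup>2" for h
  proof -
    have "L * 1 * (norm h)\<^sup>2 \<le> (L * \<kappa>) * (norm h)\<^sup>2"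
      using kappa_ge_1 L_pos by (intro mult_right_mono) auto
    then show ?thesis
      using taylor[of "(x + h, y)" "(x, y)"] le_primal[of "x + h" y] primal_upper[of "x + h" x]
      by (simp add: abs_le_iff norm_Pair inner_prod_def inner_diff_left)
  qed
  then have "(norm (g x - fst (F (x, y))))\<^sup>2 \<le> 4 * (5 / 2 * (L * \<kappa>)) * (\<Phi> x - f (x, y))"
    by (rule norm_slope_le_of_nonneg) (use L_pos kappa_ge_1 in simp)
  then show ?thesis by simp
qed


section \<open>Deterministic one-step descent of the Lyapunov function\<close>

definition "lyapunov z = 5 / 4 * \<Phi> (fst z) - 1 / 4 * f z"

text \<open>\<open>sgda_step hx hy\<close> applied to the gradient of \<open>lyapunov\<close> at
  \<open>z\<close>. As the step map is self-adjoint, pairing with \<open>e\<close> gives the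
  first-order effect of the noise \<open>e\<close>.\<close>

definition "noise_coeff hx hy z =
  (- (5 / 4 * hx) *\<^sub>R g (fst z) + (hx / 4) *\<^sub>R fst (F z), - (hy / 4) *\<^sub>R snd (F z))"

text \<open>Here \<open>v\<close> plays the role of the averaged exact gradients, \<open>e\<close>
  of the averaged noise and \<open>D\<close> of the squared deviation. Terms linear in
  \<open>v\<close> become squares by polarisation; the term linear in \<open>e\<close> is kept
  exact, because its expectation will vanish.\<close>

lemma lyapunov_step:
  assumes hy: "hy > 0" "L * hy \<le> 1 / 4" and hx: "hx = hy / (48 * \<kappa>\<^sup>2)"
    and D: "(norm (v - F z))\<^sup>2 \<le> L\<^sup>2 * D"
  shows "lyapunov (z + sgda_step hx hy (v + e)) \<le> lyapunov z - hx / 2 * (norm (g (fst z)))\<^sup>2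
     + inner (noise_coeff hx hy z) e + hy * L\<^sup>2 / 8 * D + L * hy\<^sup>2 / 2 * (norm e)\<^sup>2"
proof -
  obtain x y where z: "z = (x, y)" by (cases z)
  obtain a b where v: "v = (a, b)" by (cases v)
  obtain c d where e: "e = (c, d)" by (cases e)
  define p q r K where "p = g x" and "q = fst (F z)" and "r = snd (F z)" and "K = L * \<kappa>"
  define \<delta> where "\<delta> = \<Phi> x - f z"
  have \<delta>: "0 \<le> \<delta>" using le_primal[of x y] by (simp add: \<delta>_def z)
  have hx0: "hx > 0" using hy kappa_ge_1 by (simp add: hx)
  have L0: "L > 0" by (rule L_pos)
  have LK: "L \<le> K" using kappa_ge_1 L0 by (simp add: K_def)
  \<comment> \<open>This identity is the purpose of the factor \<open>\<kappa>\<^sup>2\<close> in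
    \<open>hx\<close>: the constant \<open>L * \<kappa>\<close> of \<open>grad_gap\<close> times
    \<open>hx\<close> is comparable to the PL gain \<open>hy * \<mu>\<close>.\<close>
  have Khx: "K * hx = hy * \<mu> / 48"
    using mu_pos L0 by (simp add: K_def hx \<kappa>_def power2_eq_square)
  have "hy * 1 \<le> hy * \<kappa>\<^sup>2" using hy kappa_ge_1 by (intro mult_left_mono) auto
  then have hx_le: "hx \<le> hy / 48"
    using kappa_ge_1 by (simp add: hx field_simps)
  \<comment> \<open>The second-order coefficient in \<open>x\<close>: \<open>5/4 * 3/2\<close> from
    \<open>\<Phi>\<close> and \<open>1/4\<close> from \<open>f\<close>. Below, \<open>X1\<close>
    absorbs its share of \<open>a\<close> and \<open>X2\<close> fits its share of the noise into the
    claimed coefficient.\<close>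
  define X where "X = 15 / 8 * (K * hx\<^sup>2) + L * hx\<^sup>2 / 4"
  have "L * hx\<^sup>2 \<le> K * hx\<^sup>2" using LK by (simp add: mult_right_mono)
  then have X: "X \<le> 17 / 8 * (K * hx\<^sup>2)" by (simp add: X_def)
  also have "K * hx\<^sup>2 = hy * \<mu> / 48 * hx" using Khx by (simp add: power2_eq_square)
  finally have X: "X \<le> 17 / 8 * (hy * \<mu> / 48 * hx)" by simp
  have "hy * \<mu> \<le> 1 / 4" using hy mu_le by (smt (verit) mult.commute mult_left_mono)
  then have "hy * \<mu> / 48 * hx \<le> 1 / 192 * hx" using hx0 by (intro mult_right_mono) linarith+
  with X have "X \<le> 17 / 8 * (1 / 192 * hx)" by (meson order_trans mult_left_mono zero_le_divide_iff zero_le_numeral)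
  then have X1: "2 * X \<le> 3 / 8 * hx" using hx0 by simp
  have "hy * \<mu> / 48 * hx \<le> hy * L / 48 * (hy / 48)"
    using hx_le hx0 hy mu_le L0 by (intro mult_mono) auto
  with X have "X \<le> 17 / 8 * (hy * L / 48 * (hy / 48))" by (meson order_trans mult_left_mono zero_le_divide_iff zero_le_numeral)
  also have "\<dots> \<le> L * hy\<^sup>2 / 4" using hy L0 by (simp add: power2_eq_square)
  finally have X2: "2 * X \<le> L * hy\<^sup>2 / 2" by simp
  have X0: "0 \<le> X" unfolding X_def using L0 LK by (intro add_nonneg_nonneg) auto
  let ?ac = "(norm (a + c))\<^sup>2" and ?bd = "(norm (b + d))\<^sup>2"
  let ?x' = "x - hx *\<^sub>R (a + c)" and ?y' = "y + hy *\<^sub>R (b + d)"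
  have step: "z + sgda_step hx hy (v + e) = (?x', ?y')"
    by (simp add: z v e sgda_step_def)
  have "norm (- (hx *\<^sub>R a) - hx *\<^sub>R c) = norm ((- hx) *\<^sub>R (a + c))"
    by (simp only: scaleR_add_right scaleR_minus_left diff_conv_add_uminus minus_add_distrib)
  then have n: "(norm (- (hx *\<^sub>R a) - hx *\<^sub>R c))\<^sup>2 = hx\<^sup>2 * ?ac" by (simp add: power_mult_distrib)
  have up: "\<Phi> ?x' \<le> \<Phi> x - hx * inner p a - hx * inner p c + 3 / 2 * (K * hx\<^sup>2) * ?ac"
    using primal_upper[of ?x' x] by (simp add: p_def K_def n algebra_simps inner_add_right)
  have n': "(norm (hy *\<^sub>R b + hy *\<^sub>R d))\<^sup>2 = hy\<^sup>2 * ?bd"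
    by (simp add: power_mult_distrib flip: scaleR_add_right)
  have lo: "f z - hx * inner q a - hx * inner q c + hy * inner r b + hy * inner r d
      - (L * hx\<^sup>2 * ?ac + L * hy\<^sup>2 * ?bd) \<le> f (?x', ?y')"
    using taylor[of "(?x', ?y')" z]
    by (simp add: z q_def r_def n n' algebra_simps inner_add_right inner_prod_def norm_Pair abs_le_iff)
  have V: "lyapunov (?x', ?y') \<le> lyapunov z + inner (noise_coeff hx hy z) e
      - hx * inner p a - hx / 4 * inner (p - q) a - hy / 4 * inner r b + X * ?ac + L * hy\<^sup>2 / 4 * ?bd"
    using up lo by (simp add: X_def lyapunov_def noise_coeff_def e z p_def q_def r_def
        inner_add_left inner_diff_left algebra_simps)
  let ?P = "(norm p)\<^sup>2" and ?A = "(norm a)\<^sup>2" and ?B = "(norm b)\<^sup>2" and ?G = "(norm (p - q))\<^sup>2"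
    and ?Q = "(norm (a - q))\<^sup>2" and ?R = "(norm (b - r))\<^sup>2"
  have "- inner p a = ((norm (p - a))\<^sup>2 - ?P - ?A) / 2"
    by (simp add: power2_norm_eq_inner algebra_simps inner_commute)
  also have "(norm (p - a))\<^sup>2 \<le> 2 * ?G + 2 * ?Q"
    using norm_add_square_le[of "p - q" "q - a"] by (simp add: norm_minus_commute)
  finally have 1: "hx * - inner p a \<le> hx * (?G + ?Q - ?P / 2 - ?A / 2)"
    using hx0 by (intro mult_left_mono) auto
  have "- inner (p - q) a \<le> ?G / 2 + ?A / 2"
    using zero_le_power2[of "norm (p - q + a)"]
    by (simp add: power2_norm_eq_inner algebra_simps inner_commute add_divide_distrib diff_divide_distrib)
  then have 2: "hx * - inner (p - q) a \<le> hx * (?G / 2 + ?A / 2)"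
    using hx0 by (intro mult_left_mono) auto
  have 3: "- inner r b = ?R / 2 - (norm r)\<^sup>2 / 2 - ?B / 2"
    by (simp add: power2_norm_eq_inner algebra_simps inner_commute)
  have 4: "hy * (2 * \<mu> * \<delta>) \<le> hy * (norm r)\<^sup>2"
    using pl_ineq[of x y] hy by (intro mult_left_mono) (auto simp: \<delta>_def r_def z)
  have "hx * ?G \<le> hx * (10 * K * \<delta>)"
    using grad_gap[of x y] hx0 by (intro mult_left_mono) (auto simp: \<delta>_def p_def q_def z K_def)
  also have "\<dots> = 10 / 48 * (hy * \<mu> * \<delta>)" using Khx by (simp add: field_simps)
  finally have 5: "hx * ?G \<le> 10 / 48 * (hy * \<mu> * \<delta>)" .
  have 6: "0 \<le> hy * \<mu> * \<delta>" using hy mu_pos \<delta> by simp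
  have "?Q + ?R \<le> L\<^sup>2 * D"
    using D by (simp add: v q_def r_def norm_prod_def)
  then have "hy / 8 * (?Q + ?R) \<le> hy / 8 * (L\<^sup>2 * D)" using hy by (intro mult_left_mono) auto
  moreover have "hx * ?Q \<le> hy / 8 * ?Q" using hx_le hy by (intro mult_right_mono) auto
  ultimately have 7: "hx * ?Q + hy / 8 * ?R \<le> hy * L\<^sup>2 / 8 * D" by (simp add: algebra_simps)
  have "X * ?ac \<le> X * (2 * ?A + 2 * (norm c)\<^sup>2)"
    using norm_add_square_le[of a c] X0 by (rule mult_left_mono)
  also have "\<dots> = (2 * X) * ?A + (2 * X) * (norm c)\<^sup>2" by (simp add: algebra_simps)
  also have "\<dots> \<le> 3 / 8 * hx * ?A + L * hy\<^sup>2 / 2 * (norm c)\<^sup>2"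
    using X1 X2 by (intro add_mono mult_right_mono) auto
  finally have 8: "X * ?ac \<le> 3 / 8 * hx * ?A + L * hy\<^sup>2 / 2 * (norm c)\<^sup>2" .
  have "L * hy\<^sup>2 / 4 * ?bd \<le> L * hy\<^sup>2 / 4 * (2 * ?B + 2 * (norm d)\<^sup>2)"
    using norm_add_square_le[of b d] L0 by (intro mult_left_mono) auto
  also have "\<dots> = L * hy\<^sup>2 / 2 * ?B + L * hy\<^sup>2 / 2 * (norm d)\<^sup>2" by (simp add: algebra_simps)
  also have "L * hy\<^sup>2 / 2 * ?B \<le> hy / 8 * ?B"
    using hy by (intro mult_right_mono) (auto simp: power2_eq_square)
  finally have 9: "L * hy\<^sup>2 / 4 * ?bd \<le> hy / 8 * ?B + L * hy\<^sup>2 / 2 * (norm d)\<^sup>2" by simp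
  have ne: "(norm e)\<^sup>2 = (norm c)\<^sup>2 + (norm d)\<^sup>2" by (simp add: e norm_Pair)
  have 10: "- (hy / 4) * inner r b = hy / 8 * ?R - hy * (norm r)\<^sup>2 / 8 - hy / 8 * ?B"
    using arg_cong[OF 3, of "\<lambda>t. hy / 4 * t"] by (simp add: algebra_simps)
  \<comment> \<open>The balance: \<open>hx * ?G\<close> has weight \<open>1 + 1/8\<close>, and
    \<open>9/8 * 10/48 < 1/4\<close> is what PL provides out of
    \<open>hy * (norm r)\<^sup>2 / 8\<close>. The \<open>?A\<close> terms cancel as
    \<open>- 1/2 + 1/8 + 3/8\<close>, the \<open>?B\<close> terms as
    \<open>- 1/8 + 1/8\<close>.\<close>
  have "lyapunov (?x', ?y') \<le> lyapunov z + inner (noise_coeff hx hy z) e - hx / 2 * ?P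
      + hy * L\<^sup>2 / 8 * D + (L * hy\<^sup>2 / 2 * (norm c)\<^sup>2 + L * hy\<^sup>2 / 2 * (norm d)\<^sup>2)"
    using V 1 2 4 5 6 7 8 9 10 unfolding right_diff_distrib distrib_left by linarith
  then show ?thesis
    unfolding step ne by (simp add: z p_def algebra_simps)
qed

end

section \<open>Square integrable random variables\<close>

definition square_integrable :: "'w measure \<Rightarrow> ('w \<Rightarrow> 'c::euclidean_space) \<Rightarrow> bool" where
  "square_integrable M u \<longleftrightarrow> u \<in> borel_measurable M \<and> integrable M (\<lambda>\<omega>. (norm (u \<omega>))\<^sup>2)"

lemma square_integrable_measurable [measurable_dest]:
  "square_integrable M u \<Longrightarrow> u \<in> borel_measurable M"
  by (simp add: square_integrable_def)

lemma square_integrableD: "square_integrable M u \<Longrightarrow> integrable M (\<lambda>\<omega>. (norm (u \<omega>))\<^sup>2)"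
  by (simp add: square_integrable_def)

lemma square_integrable_bound:
  assumes "square_integrable M u" "v \<in> borel_measurable M"
    and "\<And>\<omega>. norm (v \<omega>) \<le> C * norm (u \<omega>)"
  shows "square_integrable M v"
  unfolding square_integrable_def
proof
  show "integrable M (\<lambda>\<omega>. (norm (v \<omega>))\<^sup>2)"
  proof (rule Bochner_Integration.integrable_bound)
    show "integrable M (\<lambda>\<omega>. C\<^sup>2 * (norm (u \<omega>))\<^sup>2)"
      using assms(1) by (simp add: square_integrable_def)
    show "AE \<omega> in M. norm ((norm (v \<omega>))\<^sup>2) \<le> norm (C\<^sup>2 * (norm (u \<omega>))\<^sup>2)"
      using power_mono[OF assms(3), where n=2] by (simp add: power_mult_distrib)
  qed (use assms(2) in measurable)
qed (rule assms)

lemma square_integrable_add: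
  assumes "square_integrable M u" "square_integrable M v"
  shows "square_integrable M (\<lambda>\<omega>. u \<omega> + v \<omega>)"
  unfolding square_integrable_def
proof
  show "integrable M (\<lambda>\<omega>. (norm (u \<omega> + v \<omega>))\<^sup>2)"
  proof (rule Bochner_Integration.integrable_bound)
    show "integrable M (\<lambda>\<omega>. 2 * (norm (u \<omega>))\<^sup>2 + 2 * (norm (v \<omega>))\<^sup>2)"
      using assms by (simp add: square_integrable_def)
    show "AE \<omega> in M. norm ((norm (u \<omega> + v \<omega>))\<^sup>2) \<le> norm (2 * (norm (u \<omega>))\<^sup>2 + 2 * (norm (v \<omega>))\<^sup>2)"
      using norm_add_square_le[of "u _" "v _"] by simp
  qed (use assms in measurable)
qed (use assms in measurable)

lemma square_integrable_linear:
  assumes "bounded_linear h" "square_integrable M u"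
  shows "square_integrable M (\<lambda>\<omega>. h (u \<omega>))"
proof -
  have "h \<in> borel_measurable borel"
    using assms(1) by (intro borel_measurable_continuous_onI linear_continuous_on)
  then have "(\<lambda>\<omega>. h (u \<omega>)) \<in> borel_measurable M" using assms(2) by measurable
  moreover obtain K where "\<And>x. norm (h x) \<le> K * norm x"
    using bounded_linear.bounded[OF assms(1)] by (metis mult.commute)
  ultimately show ?thesis by (rule square_integrable_bound[OF assms(2)])
qed

lemmas square_integrable_scaleR = square_integrable_linear[OF bounded_linear_scaleR_right]

lemma square_integrable_diff:
  assumes "square_integrable M u" "square_integrable M v"
  shows "square_integrable M (\<lambda>\<omega>. u \<omega> - v \<omega>)"
  using square_integrable_add[OF assms(1) square_integrable_scaleR[OF assms(2), of "-1"]] by simp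

lemma (in finite_measure) square_integrable_const: "square_integrable M (\<lambda>\<omega>. c)"
  by (simp add: square_integrable_def)

lemma (in finite_measure) square_integrable_sum:
  "(\<And>i. i \<in> I \<Longrightarrow> square_integrable M (u i)) \<Longrightarrow> square_integrable M (\<lambda>\<omega>. \<Sum>i\<in>I. u i \<omega>)"
  by (induction I rule: infinite_finite_induct) (auto intro: square_integrable_const square_integrable_add)

lemma square_integrable_inner:
  assumes "square_integrable M u" "square_integrable M v"
  shows "integrable M (\<lambda>\<omega>. inner (u \<omega>) (v \<omega>))"
proof (rule Bochner_Integration.integrable_bound)
  show "integrable M (\<lambda>\<omega>. (norm (u \<omega>))\<^sup>2 + (norm (v \<omega>))\<^sup>2)"
    using assms by (simp add: square_integrable_def)
  show "AE \<omega> in M. norm (inner (u \<omega>) (v \<omega>)) \<le> norm ((norm (u \<omega>))\<^sup>2 + (norm (v \<omega>))\<^sup>2)"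
  proof (intro AE_I2)
    fix \<omega>
    have "\<bar>inner (u \<omega>) (v \<omega>)\<bar> \<le> norm (u \<omega>) * norm (v \<omega>)" by (rule Cauchy_Schwarz_ineq2)
    also have "\<dots> \<le> 2 * norm (u \<omega>) * norm (v \<omega>)" by simp
    also have "\<dots> \<le> (norm (u \<omega>))\<^sup>2 + (norm (v \<omega>))\<^sup>2" by (rule sum_squares_bound)
    finally show "norm (inner (u \<omega>) (v \<omega>)) \<le> norm ((norm (u \<omega>))\<^sup>2 + (norm (v \<omega>))\<^sup>2)" by simp
  qed
qed (use assms in measurable)

lemma (in finite_measure) square_integrable_imp_integrable_norm:
  assumes "square_integrable M u" shows "integrable M (\<lambda>\<omega>. norm (u \<omega>))"
proof (rule Bochner_Integration.integrable_bound)
  show "integrable M (\<lambda>\<omega>. 1 + (norm (u \<omega>))\<^sup>2)"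
    using assms by (simp add: square_integrable_def)
  have "t \<le> 1 + t\<^sup>2" for t :: real 
    using zero_le_power2[of "t - 1 / 2"] by (simp add: power2_diff power_divide)
  then show "AE \<omega> in M. norm (norm (u \<omega>)) \<le> norm (1 + (norm (u \<omega>))\<^sup>2)" by simp
qed (use assms in measurable)

lemma borel_measurable_lipschitz:
  fixes g :: "'z::euclidean_space \<Rightarrow> 'c::euclidean_space"
  assumes "\<And>x y. norm (g x - g y) \<le> B * norm (x - y)"
  shows "g \<in> borel_measurable borel"
proof (rule borel_measurable_continuous_onI)
  have "(\<bar>B\<bar>)-lipschitz_on UNIV g"
  proof (rule lipschitz_onI)
    fix x y :: 'z
    have "B * norm (x - y) \<le> \<bar>B\<bar> * norm (x - y)" by (intro mult_right_mono) auto
    with assms[of x y] show "dist (g x) (g y) \<le> \<bar>B\<bar> * dist x y" by (simp add: dist_norm)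
  qed simp
  then show "continuous_on UNIV g" by (rule lipschitz_on_continuous_on)
qed

lemma (in finite_measure) square_integrable_lipschitz:
  assumes "square_integrable M u" and g: "\<And>x y. norm (g x - g y) \<le> B * norm (x - y)"
  shows "square_integrable M (\<lambda>\<omega>. g (u \<omega>))"
proof -
  have [measurable]: "g \<in> borel_measurable borel" using g by (rule borel_measurable_lipschitz)
  have "square_integrable M (\<lambda>\<omega>. g (u \<omega>) - g 0)"
    by (rule square_integrable_bound[OF assms(1), of _ B]) (use assms(1) in measurable, use g[of _ 0] in simp)
  from square_integrable_add[OF this square_integrable_const[of "g 0"]] show ?thesis by simp
qed

text \<open>Removing the affine part leaves a function dominated by the squared norm. It is applied
  to \<open>f\<close> and \<open>\<Phi>\<close>, which need not be bounded.\<close>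

lemma integrable_quadratic_growth:
  assumes "finite_measure M" "square_integrable M u" 
    and \<phi>: "\<And>x. \<bar>\<phi> x - \<phi> 0 - inner v x\<bar> \<le> B * (norm x)\<^sup>2" "\<phi> \<in> borel_measurable borel"
  shows "integrable M (\<lambda>\<omega>. \<phi> (u \<omega>))"
proof -
  interpret finite_measure M by fact
  have "integrable M (\<lambda>\<omega>. \<phi> (u \<omega>) - \<phi> 0 - inner v (u \<omega>))"
  proof (rule Bochner_Integration.integrable_bound)
    show "integrable M (\<lambda>\<omega>. B * (norm (u \<omega>))\<^sup>2)" using assms by (simp add: square_integrable_def)
    show "AE \<omega> in M. norm (\<phi> (u \<omega>) - \<phi> 0 - inner v (u \<omega>)) \<le> norm (B * (norm (u \<omega>))\<^sup>2)"
    proof (intro AE_I2)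
      fix \<omega>
      show "norm (\<phi> (u \<omega>) - \<phi> 0 - inner v (u \<omega>)) \<le> norm (B * (norm (u \<omega>))\<^sup>2)"
        using \<phi>(1)[of "u \<omega>"] by simp
    qed
  qed (use assms in measurable)
  moreover have "integrable M (\<lambda>\<omega>. inner v (u \<omega>))"
    by (intro square_integrable_inner square_integrable_const assms)
  ultimately have "integrable M (\<lambda>\<omega>. (\<phi> (u \<omega>) - \<phi> 0 - inner v (u \<omega>)) + inner v (u \<omega>) + \<phi> 0)"
    by (intro Bochner_Integration.integrable_add) auto
  then show ?thesis by simp
qed

context prob_space
begin

text \<open>Fubini on the joint law of \<open>((z, u), Y)\<close>.\<close>
lemma noise_moments:
  fixes z u :: "'a \<Rightarrow> 'z::euclidean_space" and N :: "'z \<Rightarrow> 's \<Rightarrow> 'z"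
  assumes F: "space F = space M" "sets F \<subseteq> events" and z: "z \<in> borel_measurable F" and uF: "u \<in> borel_measurable F"
    and Y [measurable]: "Y \<in> measurable M D" and law: "distr M D Y = D"
    and indep: "\<And>A B. A \<in> sets F \<Longrightarrow> B \<in> sets D \<Longrightarrow>
      prob (A \<inter> (Y -` B \<inter> space M)) = prob A * prob (Y -` B \<inter> space M)"
    and N [measurable]: "(\<lambda>(z, s). N z s) \<in> borel_measurable (borel \<Otimes>\<^sub>M D)"
    and mean: "\<And>z. integrable D (N z)" "\<And>z. (LINT s|D. N z s) = 0"
    and var: "\<And>z. integrable D (\<lambda>s. (norm (N z s))\<^sup>2)" "\<And>z. (LINT s|D. (norm (N z s))\<^sup>2) \<le> v"
    and u: "square_integrable M u"
  shows "square_integrable M (\<lambda>\<omega>. N (z \<omega>) (Y \<omega>))"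
    and "expectation (\<lambda>\<omega>. (norm (N (z \<omega>) (Y \<omega>)))\<^sup>2) \<le> v"
    and "expectation (\<lambda>\<omega>. inner (u \<omega>) (N (z \<omega>) (Y \<omega>))) = 0"
proof -
  have sub: "measurable F borel \<subseteq> measurable M borel"
    using F by (auto simp: measurable_def)
  have [measurable]: "z \<in> borel_measurable M" "u \<in> borel_measurable M"
    using z uF sub by auto
  define PX where "PX = distr M borel (\<lambda>\<omega>. (z \<omega>, u \<omega>))"
  interpret PX: prob_space PX unfolding PX_def by (rule prob_space_distr) measurable
  interpret D: prob_space D using prob_space_distr[OF Y] law by simp
  interpret P: pair_prob_space PX D ..
  \<comment> \<open>Independence on rectangles determines the joint law. Pairing \<open>z\<close>
    with \<open>u\<close> retains the dependence between these two.\<close>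
  have joint: "distr M (borel \<Otimes>\<^sub>M D) (\<lambda>\<omega>. ((z \<omega>, u \<omega>), Y \<omega>)) = PX \<Otimes>\<^sub>M D"
  proof (rule pair_measure_eqI[symmetric])
    fix A B assume A: "A \<in> sets PX" and B: "B \<in> sets D"
    let ?A = "(\<lambda>\<omega>. (z \<omega>, u \<omega>)) -` A \<inter> space M"
    have "(\<lambda>\<omega>. (z \<omega>, u \<omega>)) \<in> borel_measurable F" using z uF by (simp add: borel_measurable_Pair)
    then have "?A \<in> sets F" using A F(1) measurable_sets[of _ F borel A] by (simp add: PX_def)
    from indep[OF this B] 
    have "prob (?A \<inter> (Y -` B \<inter> space M)) = prob ?A * prob (Y -` B \<inter> space M)" .
    also have "?A \<inter> (Y -` B \<inter> space M) = (\<lambda>\<omega>. ((z \<omega>, u \<omega>), Y \<omega>)) -` (A \<times> B) \<inter> space M" by auto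
    finally have "prob ((\<lambda>\<omega>. ((z \<omega>, u \<omega>), Y \<omega>)) -` (A \<times> B) \<inter> space M) = prob ?A * prob (Y -` B \<inter> space M)" .
    moreover have "emeasure D B = emeasure M (Y -` B \<inter> space M)"
      using emeasure_distr[OF Y B] law by simp
    moreover have "emeasure PX A = emeasure M ?A"
      unfolding PX_def using A by (intro emeasure_distr) (auto simp: PX_def)
    moreover have "emeasure (distr M (borel \<Otimes>\<^sub>M D) (\<lambda>\<omega>. ((z \<omega>, u \<omega>), Y \<omega>))) (A \<times> B)
        = emeasure M ((\<lambda>\<omega>. ((z \<omega>, u \<omega>), Y \<omega>)) -` (A \<times> B) \<inter> space M)"
      using A B by (intro emeasure_distr pair_measureI) (auto simp: PX_def)
    ultimately show "emeasure PX A * emeasure D B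
        = emeasure (distr M (borel \<Otimes>\<^sub>M D) (\<lambda>\<omega>. ((z \<omega>, u \<omega>), Y \<omega>))) (A \<times> B)"
      by (simp add: emeasure_eq_measure ennreal_mult')
  next
    show "sets (PX \<Otimes>\<^sub>M D) = sets (distr M (borel \<Otimes>\<^sub>M D) (\<lambda>\<omega>. ((z \<omega>, u \<omega>), Y \<omega>)))"
      by (simp add: PX_def cong: sets_pair_measure_cong)
  qed unfold_locales
  have sPX [measurable_cong]: "sets PX = sets borel" by (simp add: PX_def)
  have [measurable]: "(\<lambda>p. N (fst (fst p)) (snd p)) \<in> borel_measurable ((borel :: ('z \<times> 'z) measure) \<Otimes>\<^sub>M D)"
  proof -
    have "(\<lambda>p::('z \<times> 'z) \<times> 's. (fst (fst p), snd p)) \<in> measurable (borel \<Otimes>\<^sub>M D) (borel \<Otimes>\<^sub>M D)"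
      by (simp flip: borel_prod)
    from measurable_compose[OF this N] show ?thesis by simp
  qed
  have [measurable]: "(\<lambda>p. snd (fst p)) \<in> borel_measurable ((borel :: ('z \<times> 'z) measure) \<Otimes>\<^sub>M D)"
    by (simp flip: borel_prod)
  have J [measurable]: "(\<lambda>\<omega>. ((z \<omega>, u \<omega>), Y \<omega>)) \<in> measurable M (borel \<Otimes>\<^sub>M D)"
    by measurable
  have [measurable]: "(\<lambda>\<omega>. N (z \<omega>) (Y \<omega>)) \<in> borel_measurable M"
    by (rule measurable_compose[OF J, of "\<lambda>p. N (fst (fst p)) (snd p)", simplified]) measurable
  have v0: "0 \<le> v" using var(2)[of 0] by (rule order_trans[rotated]) simp
  \<comment> \<open>The nonnegative integral presupposes no integrability, so its bound also proves
    square integrability. It holds for every law of \<open>z\<close>, as \<open>v\<close> is uniform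
    in the point.\<close>
  have "(\<integral>\<^sup>+\<omega>. ennreal ((norm (N (z \<omega>) (Y \<omega>)))\<^sup>2) \<partial>M)
      = (\<integral>\<^sup>+p. ennreal ((norm (N (fst (fst p)) (snd p)))\<^sup>2) \<partial>(PX \<Otimes>\<^sub>M D))"
    unfolding joint[symmetric] by (subst nn_integral_distr) (auto intro: J)
  also have "\<dots> = (\<integral>\<^sup>+x. (\<integral>\<^sup>+s. ennreal ((norm (N (fst x) s))\<^sup>2) \<partial>D) \<partial>PX)"
    by (subst D.nn_integral_fst[symmetric]) auto
  also have "\<dots> \<le> (\<integral>\<^sup>+x. ennreal v \<partial>PX)"
    using var by (intro nn_integral_mono) (simp add: nn_integral_eq_integral ennreal_leI)
  also have "\<dots> = ennreal v" by (simp add: PX.emeasure_space_1)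
  finally have nn: "(\<integral>\<^sup>+\<omega>. ennreal ((norm (N (z \<omega>) (Y \<omega>)))\<^sup>2) \<partial>M) \<le> ennreal v" .
  then show sq: "square_integrable M (\<lambda>\<omega>. N (z \<omega>) (Y \<omega>))"
    unfolding square_integrable_def
    by (auto intro!: integrableI_bounded simp: less_top[symmetric] top_unique)
  then have "integrable M (\<lambda>\<omega>. (norm (N (z \<omega>) (Y \<omega>)))\<^sup>2)" by (simp add: square_integrable_def)
  from nn_integral_eq_integral[OF this] nn v0
  show "expectation (\<lambda>\<omega>. (norm (N (z \<omega>) (Y \<omega>)))\<^sup>2) \<le> v" by simp
  have int: "integrable (PX \<Otimes>\<^sub>M D) (\<lambda>p. inner (snd (fst p)) (N (fst (fst p)) (snd p)))"
    unfolding joint[symmetric]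
    using square_integrable_inner[OF u sq] by (subst integrable_distr_eq) auto
  have "expectation (\<lambda>\<omega>. inner (u \<omega>) (N (z \<omega>) (Y \<omega>)))
      = (\<integral>p. inner (snd (fst p)) (N (fst (fst p)) (snd p)) \<partial>(PX \<Otimes>\<^sub>M D))"
    unfolding joint[symmetric] by (subst integral_distr) auto
  also have "\<dots> = (\<integral>x. (\<integral>s. inner (snd x) (N (fst x) s) \<partial>D) \<partial>PX)"
    using P.integral_fst'[OF int] by simp
  also have "\<dots> = 0" using mean by simp
  finally show "expectation (\<lambda>\<omega>. inner (u \<omega>) (N (z \<omega>) (Y \<omega>))) = 0" .
qed

end

section \<open>Local SGDA as a stochastic process\<close>

text \<open>Only gradient fields occur here, not the losses behind them; \<open>H\<close> bounds the
  heterogeneity of both components together.\<close>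

locale sgda_run = prob_space M
  for M :: "'w measure" +
  fixes n \<tau> :: nat and D :: "nat \<Rightarrow> 's measure"
    and G :: "nat \<Rightarrow> 'a::euclidean_space \<times> 'b::euclidean_space \<Rightarrow> 's \<Rightarrow> 'a \<times> 'b"
    and Fi :: "nat \<Rightarrow> 'a \<times> 'b \<Rightarrow> 'a \<times> 'b" and F :: "'a \<times> 'b \<Rightarrow> 'a \<times> 'b"
    and \<xi> :: "nat \<Rightarrow> nat \<Rightarrow> 'w \<Rightarrow> 's" and hx hy L \<sigma> H :: real and x0 :: 'a and y0 :: 'b
  assumes n_ge_1: "n \<ge> 1" and tau_ge_1: "\<tau> \<ge> 1" and hx: "0 \<le> hx" "hx \<le> hy" and L_nonneg: "0 \<le> L"
    and samples: "independent_samples n D M \<xi>"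
    and G_meas: "i < n \<Longrightarrow> (\<lambda>(z, s). G i z s) \<in> borel_measurable (borel \<Otimes>\<^sub>M D i)"
    and G_int: "i < n \<Longrightarrow> integrable (D i) (G i z)"
    and G_mean: "i < n \<Longrightarrow> (LINT s|D i. G i z s) = Fi i z"
    and G_sq_int: "i < n \<Longrightarrow> integrable (D i) (\<lambda>s. (norm (G i z s - Fi i z))\<^sup>2)"
    and G_var: "i < n \<Longrightarrow> (LINT s|D i. (norm (G i z s - Fi i z))\<^sup>2) \<le> \<sigma>\<^sup>2"
    and Fi_lip: "i < n \<Longrightarrow> norm (Fi i z - Fi i z') \<le> L * norm (z - z')"
    and F_avg: "F z = (1 / real n) *\<^sub>R (\<Sum>i<n. Fi i z)"
    and het: "(\<Sum>i<n. (norm (Fi i z - F z))\<^sup>2) \<le> real n * H"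
begin

section \<open>Pathwise recursions for the average and the deviation\<close>

definition "Z t \<omega> i = local_sgda n G hx hy \<tau> x0 y0 (\<lambda>k i. \<xi> k i \<omega>) t i"
definition "N t \<omega> i = G i (Z t \<omega> i) (\<xi> t i \<omega>) - Fi i (Z t \<omega> i)"
definition "W t \<omega> i = Z t \<omega> i + sgda_step hx hy (Fi i (Z t \<omega> i) + N t \<omega> i)"
definition "zbar t \<omega> = (1 / real n) *\<^sub>R (\<Sum>i<n. Z t \<omega> i)"
definition "vbar t \<omega> = (1 / real n) *\<^sub>R (\<Sum>i<n. Fi i (Z t \<omega> i))"
definition "ebar t \<omega> = (1 / real n) *\<^sub>R (\<Sum>i<n. N t \<omega> i)"
definition "dev t \<omega> = (\<Sum>i<n. (norm (Z t \<omega> i - zbar t \<omega>))\<^sup>2) / real n"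

lemma Z_0: "Z 0 \<omega> i = (x0, y0)"
  by (simp add: Z_def)

lemma Z_Suc: "Z (Suc t) \<omega> i = (if \<tau> dvd Suc t then (1 / real n) *\<^sub>R (\<Sum>j<n. W t \<omega> j) else W t \<omega> i)"
  by (simp add: Z_def W_def N_def Let_def sgda_step_def plus_prod_def)

lemma mean_W: "(1 / real n) *\<^sub>R (\<Sum>i<n. W t \<omega> i) = zbar t \<omega> + sgda_step hx hy (vbar t \<omega> + ebar t \<omega>)"
  by (simp add: W_def zbar_def vbar_def ebar_def sum.distrib scaleR_add_right sgda_step_simps)

text \<open>Synchronisation does not change the mean, so the averaged iterate follows one recursion
  at all times.\<close>

lemma zbar_Suc: "zbar (Suc t) \<omega> = zbar t \<omega> + sgda_step hx hy (vbar t \<omega> + ebar t \<omega>)"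
proof -
  have "zbar (Suc t) \<omega> = (1 / real n) *\<^sub>R (\<Sum>i<n. W t \<omega> i)"
    using n_ge_1 by (cases "\<tau> dvd Suc t") (simp_all add: zbar_def Z_Suc sum_constant_scaleR)
  then show ?thesis by (simp only: mean_W)
qed

lemma Fi_lip_square:
  assumes "i < n" shows "(norm (Fi i z - Fi i z'))\<^sup>2 \<le> L\<^sup>2 * (norm (z - z'))\<^sup>2"
  using power_mono[OF Fi_lip[OF assms, of z z'], of 2] by (simp add: power_mult_distrib)

lemma vbar_error: "(norm (vbar t \<omega> - F (zbar t \<omega>)))\<^sup>2 \<le> L\<^sup>2 * dev t \<omega>"
proof -
  let ?d = "\<lambda>i. Fi i (Z t \<omega> i) - Fi i (zbar t \<omega>)"
  have "vbar t \<omega> - F (zbar t \<omega>) = (1 / real n) *\<^sub>R (\<Sum>i<n. ?d i)"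
    by (simp add: vbar_def F_avg sum_subtractf scaleR_diff_right)
  then have "(norm (vbar t \<omega> - F (zbar t \<omega>)))\<^sup>2 = (norm (\<Sum>i<n. ?d i))\<^sup>2 / (real n)\<^sup>2"
    by (simp add: power_divide)
  also have "\<dots> \<le> (real n * (\<Sum>i<n. (norm (?d i))\<^sup>2)) / (real n)\<^sup>2"
    using norm_sum_square_le[of ?d "{..<n}"] by (intro divide_right_mono) auto
  also have "\<dots> = (\<Sum>i<n. (norm (?d i))\<^sup>2) / real n" by (simp add: power2_eq_square)
  also have "\<dots> \<le> (\<Sum>i<n. L\<^sup>2 * (norm (Z t \<omega> i - zbar t \<omega>))\<^sup>2) / real n"
    using Fi_lip_square by (intro divide_right_mono sum_mono) auto
  also have "\<dots> = L\<^sup>2 * dev t \<omega>" by (simp add: dev_def sum_distrib_left)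
  finally show ?thesis .
qed

lemma dev_sync: "\<tau> dvd t \<Longrightarrow> dev t \<omega> = 0"
proof (cases t)
  case 0
  then show ?thesis using n_ge_1 by (simp add: dev_def zbar_def Z_0 sum_constant_scaleR)
next
  case (Suc k)
  assume "\<tau> dvd t"
  with Suc n_ge_1 show ?thesis by (simp add: dev_def zbar_def Z_Suc sum_constant_scaleR)
qed

text \<open>An upper bound for the mean squared deviation of the stochastic gradients from their average,
  obtained by comparing them with \<open>F (zbar t \<omega>)\<close> instead.\<close>
definition "spread t \<omega> = 3 * ((\<Sum>i<n. (norm (N t \<omega> i))\<^sup>2) / real n) + 3 * L\<^sup>2 * dev t \<omega> + 3 * H"

text \<open>A local step adds \<open>?b i\<close> to the deviation of client \<open>i\<close>, and
  \<open>sum_norm_sub_mean_le\<close> bounds these increments by the spread about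
  \<open>F (zbar t \<omega>)\<close>. The second claim serves the step right after a
  synchronisation, where no old deviation has to be weighed against the new one.\<close>

lemma dev_Suc:
  assumes nsync: "\<not> \<tau> dvd Suc t"
  shows "r > 0 \<Longrightarrow> dev (Suc t) \<omega> \<le> (1 + 1 / r) * dev t \<omega> + (1 + r) * (hy\<^sup>2 * spread t \<omega>)"
    and "dev t \<omega> = 0 \<Longrightarrow> dev (Suc t) \<omega> \<le> hy\<^sup>2 * spread t \<omega>"
proof -
  let ?v = "\<lambda>i. Fi i (Z t \<omega> i) + N t \<omega> i"
  let ?b = "\<lambda>i. sgda_step hx hy (?v i - (vbar t \<omega> + ebar t \<omega>))"
  let ?a = "\<lambda>i. Z t \<omega> i - zbar t \<omega>"
  have W: "Z (Suc t) \<omega> i - zbar (Suc t) \<omega> = ?a i + ?b i" for i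
    using nsync by (simp add: Z_Suc zbar_Suc W_def sgda_step_simps)
  have m: "vbar t \<omega> + ebar t \<omega> = (1 / real n) *\<^sub>R (\<Sum>i<n. ?v i)"
    by (simp add: vbar_def ebar_def sum.distrib scaleR_add_right)
  have "(\<Sum>i<n. (norm (?v i - F (zbar t \<omega>)))\<^sup>2) \<le> (\<Sum>i<n. 3 * ((norm (N t \<omega> i))\<^sup>2
      + L\<^sup>2 * (norm (?a i))\<^sup>2 + (norm (Fi i (zbar t \<omega>) - F (zbar t \<omega>)))\<^sup>2))"
  proof (intro sum_mono)
    fix i assume "i \<in> {..<n}"
    then have "(norm (Fi i (Z t \<omega> i) - Fi i (zbar t \<omega>)))\<^sup>2 \<le> L\<^sup>2 * (norm (?a i))\<^sup>2"
      by (intro Fi_lip_square) auto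
    then show "(norm (?v i - F (zbar t \<omega>)))\<^sup>2 \<le> 3 * ((norm (N t \<omega> i))\<^sup>2
      + L\<^sup>2 * (norm (?a i))\<^sup>2 + (norm (Fi i (zbar t \<omega>) - F (zbar t \<omega>)))\<^sup>2)"
      using norm_add3_square_le[of "N t \<omega> i" "Fi i (Z t \<omega> i) - Fi i (zbar t \<omega>)"
          "Fi i (zbar t \<omega>) - F (zbar t \<omega>)"] by (simp add: algebra_simps)
  qed
  also have "\<dots> = 3 * (\<Sum>i<n. (norm (N t \<omega> i))\<^sup>2) + 3 * L\<^sup>2 * (\<Sum>i<n. (norm (?a i))\<^sup>2)
      + 3 * (\<Sum>i<n. (norm (Fi i (zbar t \<omega>) - F (zbar t \<omega>)))\<^sup>2)"
    by (simp add: sum.distrib sum_distrib_left algebra_simps)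
  also have "\<dots> \<le> 3 * (\<Sum>i<n. (norm (N t \<omega> i))\<^sup>2) + 3 * L\<^sup>2 * (\<Sum>i<n. (norm (?a i))\<^sup>2) + 3 * (real n * H)"
    using het by simp
  also have "\<dots> = real n * spread t \<omega>"
    using n_ge_1 by (simp add: spread_def dev_def algebra_simps)
  finally have sp: "(\<Sum>i<n. (norm (?v i - F (zbar t \<omega>)))\<^sup>2) \<le> real n * spread t \<omega>" .
  have "(\<Sum>i<n. (norm (?b i))\<^sup>2) \<le> (\<Sum>i<n. hy\<^sup>2 * (norm (?v i - (vbar t \<omega> + ebar t \<omega>)))\<^sup>2)"
    unfolding power_mult_distrib[symmetric]
    by (intro sum_mono power_mono norm_sgda_step_le hx norm_ge_zero)
  also have "\<dots> \<le> hy\<^sup>2 * (\<Sum>i<n. (norm (?v i - F (zbar t \<omega>)))\<^sup>2)"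
    unfolding sum_distrib_left[symmetric] m
    by (intro mult_left_mono sum_norm_sub_mean_le n_ge_1) auto
  also have "\<dots> \<le> hy\<^sup>2 * (real n * spread t \<omega>)" using sp by (rule mult_left_mono) simp
  finally have b: "(\<Sum>i<n. (norm (?b i))\<^sup>2) / real n \<le> hy\<^sup>2 * spread t \<omega>"
    using n_ge_1 by (simp add: field_simps)
  show "dev (Suc t) \<omega> \<le> (1 + 1 / r) * dev t \<omega> + (1 + r) * (hy\<^sup>2 * spread t \<omega>)" if "r > 0"
  proof -
    have "dev (Suc t) \<omega> \<le> (\<Sum>i<n. (1 + 1 / r) * (norm (?a i))\<^sup>2 + (1 + r) * (norm (?b i))\<^sup>2) / real n"
      unfolding dev_def W using norm_add_square_le_weighted[OF that]
      by (intro divide_right_mono sum_mono) auto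
    also have "\<dots> = (1 + 1 / r) * dev t \<omega> + (1 + r) * ((\<Sum>i<n. (norm (?b i))\<^sup>2) / real n)"
      unfolding dev_def sum.distrib by (simp only: add_divide_distrib sum_distrib_left[symmetric] times_divide_eq_right)
    also have "\<dots> \<le> (1 + 1 / r) * dev t \<omega> + (1 + r) * (hy\<^sup>2 * spread t \<omega>)"
      using b that by (intro add_left_mono mult_left_mono) auto
    finally show ?thesis .
  qed
  show "dev (Suc t) \<omega> \<le> hy\<^sup>2 * spread t \<omega>" if "dev t \<omega> = 0"
  proof -
    have "(\<Sum>i<n. (norm (?a i))\<^sup>2) = 0" using that n_ge_1 by (simp add: dev_def)
    then have "?a i = 0" if "i < n" for i
      using that by (subst (asm) sum_nonneg_eq_0_iff) auto
    then have "dev (Suc t) \<omega> = (\<Sum>i<n. (norm (?b i))\<^sup>2) / real n"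
      unfolding dev_def W by simp
    with b show ?thesis by simp
  qed
qed

section \<open>Independence, adaptedness and moments of the noise\<close>

lemma \<xi>_meas [measurable]: "i < n \<Longrightarrow> \<xi> t i \<in> measurable M (D i)"
  and \<xi>_law: "i < n \<Longrightarrow> distr M (D i) (\<xi> t i) = D i"
  and \<xi>_indep: "indep_vars (\<lambda>(t, i). D i) (\<lambda>(t, i). \<xi> t i) (UNIV \<times> {..<n})"
  using samples by (auto simp: independent_samples_def)

lemma prob_space_D: "i < n \<Longrightarrow> prob_space (D i)"
  using prob_space_distr[OF \<xi>_meas, of i 0] \<xi>_law[of i 0] by simp

lemma Fi_meas [measurable]: "i < n \<Longrightarrow> Fi i \<in> borel_measurable borel"
  using Fi_lip by (rule borel_measurable_lipschitz)

text \<open>The \<open>\<sigma>\<close>-algebra \<open>history t i\<close> contains the samples that the other clients draw in iteration \<open>t\<close>, so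
  that orthogonality to it also covers the cross terms in the variance of \<open>ebar t\<close>.\<close>
definition "others t i = {..t} \<times> {..<n} - {(t, i)}"
definition "samples_vec J \<omega> = (\<lambda>(k, j)\<in>J. \<xi> k j \<omega>)"
definition "history t i = vimage_algebra (space M) (samples_vec (others t i))
    (PiM (others t i) (\<lambda>(k, j). D j))"

lemma samples_vec_meas: "J \<subseteq> UNIV \<times> {..<n} \<Longrightarrow> samples_vec J \<in> measurable M (PiM J (\<lambda>(k, j). D j))"
  unfolding samples_vec_def by (intro measurable_restrict) auto

lemma others_subset: "others t i \<subseteq> UNIV \<times> {..<n}"
  by (auto simp: others_def)

lemma space_history: "space (history t i) = space M"
  by (simp add: history_def)

lemma sets_history: "sets (history t i) =
    {samples_vec (others t i) -` A \<inter> space M | A. A \<in> sets (PiM (others t i) (\<lambda>(k, j). D j))}"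
  unfolding history_def
  using measurable_space[OF samples_vec_meas[OF others_subset]] by (intro sets_vimage_algebra2) blast

lemma sets_history_subset: "sets (history t i) \<subseteq> events"
  unfolding sets_history using samples_vec_meas[OF others_subset] by auto

lemma \<xi>_history_meas:
  assumes "(k, j) \<in> others t i" shows "\<xi> k j \<in> measurable (history t i) (D j)"
proof -
  have "samples_vec (others t i) \<in> measurable (history t i) (PiM (others t i) (\<lambda>(k, j). D j))"
    unfolding history_def
    using measurable_space[OF samples_vec_meas[OF others_subset]]
    by (intro measurable_vimage_algebra1) blast
  from measurable_compose[OF this measurable_component_singleton[OF assms]]
  show ?thesis using assms by (simp add: samples_vec_def)
qed

text \<open>\<open>others t i\<close> and \<open>{(t, i)}\<close> are disjoint blocks of an
  independent family, so the sample vectors over them are independent.\<close>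

lemma history_indep:
  assumes i: "i < n" and A: "A \<in> sets (history t i)" and B: "B \<in> sets (D i)"
  shows "prob (A \<inter> (\<xi> t i -` B \<inter> space M)) = prob A * prob (\<xi> t i -` B \<inter> space M)"
proof -
  let ?J = "others t i" and ?K = "{(t, i)}" and ?D = "\<lambda>(k::nat, j). D j"
  have "indep_var (PiM ?J ?D) (\<lambda>\<omega>. restrict (\<lambda>p. (\<lambda>(t, i). \<xi> t i) p \<omega>) ?J)
      (PiM ?K ?D) (\<lambda>\<omega>. restrict (\<lambda>p. (\<lambda>(t, i). \<xi> t i) p \<omega>) ?K)"
    using i by (intro indep_var_restrict[OF \<xi>_indep]) (auto simp: others_def)
  moreover have "(\<lambda>\<omega>. restrict (\<lambda>p. (\<lambda>(t, i). \<xi> t i) p \<omega>) J) = samples_vec J" for J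
    by (auto simp: samples_vec_def fun_eq_iff restrict_def)
  ultimately have "indep_var (PiM ?J ?D) (samples_vec ?J) (PiM ?K ?D) (samples_vec ?K)" by simp
  then have "indep_set
      (sigma_sets (space M) {samples_vec ?J -` A \<inter> space M | A. A \<in> sets (PiM ?J ?D)})
      (sigma_sets (space M) {samples_vec ?K -` A \<inter> space M | A. A \<in> sets (PiM ?K ?D)})"
    by (simp add: indep_var_eq)
  then show ?thesis
  proof (rule indep_setD)
    show "A \<in> sigma_sets (space M) {samples_vec ?J -` A \<inter> space M | A. A \<in> sets (PiM ?J ?D)}"
      using A unfolding sets_history by (rule sigma_sets.Basic)
    \<comment> \<open>The event about \<open>\<xi> t i\<close> is rewritten as one about the sample
      vector over a single index.\<close>
    have "(\<lambda>f. f (t, i)) \<in> measurable (PiM ?K ?D) (D i)"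
      using measurable_component_singleton[of "(t, i)" ?K ?D] by simp
    from measurable_sets[OF this B]
    have "(\<lambda>f. f (t, i)) -` B \<inter> space (PiM ?K ?D) \<in> sets (PiM ?K ?D)" .
    moreover have "\<xi> t i -` B \<inter> space M =
        samples_vec ?K -` ((\<lambda>f. f (t, i)) -` B \<inter> space (PiM ?K ?D)) \<inter> space M"
      using measurable_space[OF samples_vec_meas[of ?K]] i by (auto simp: samples_vec_def)
    ultimately show "\<xi> t i -` B \<inter> space M
        \<in> sigma_sets (space M) {samples_vec ?K -` A \<inter> space M | A. A \<in> sets (PiM ?K ?D)}"
      by (blast intro: sigma_sets.Basic)
  qed
qed

lemma noise_meas:
  assumes "i < n" "(\<lambda>\<omega>. Z t \<omega> i) \<in> borel_measurable R" "\<xi> t i \<in> measurable R (D i)"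
  shows "(\<lambda>\<omega>. N t \<omega> i) \<in> borel_measurable R"
proof -
  have "(\<lambda>\<omega>. (Z t \<omega> i, \<xi> t i \<omega>)) \<in> measurable R (borel \<Otimes>\<^sub>M D i)"
    using assms by (intro measurable_Pair)
  from measurable_compose[OF this G_meas[OF assms(1)]]
    measurable_compose[OF assms(2) Fi_meas[OF assms(1)]]
  show ?thesis unfolding N_def by simp
qed

text \<open>The \<sigma>-algebra \<open>R\<close> is left open because adaptedness requires the
  smaller \<open>history t i\<close> in place of \<open>M\<close>.\<close>

lemma Z_meas:
  assumes "\<And>k j. k < t \<Longrightarrow> j < n \<Longrightarrow> \<xi> k j \<in> measurable R (D j)" and "i < n"
  shows "(\<lambda>\<omega>. Z t \<omega> i) \<in> borel_measurable R"
  using assms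
proof (induction t arbitrary: i)
  case 0
  then show ?case by (simp add: Z_0)
next
  case (Suc t)
  have [measurable]: "sgda_step hx hy \<in> borel_measurable borel"
    by (intro borel_measurable_continuous_onI linear_continuous_on bounded_linear_sgda_step)
  have [measurable]: "(\<lambda>\<omega>. W t \<omega> j) \<in> borel_measurable R" if "j < n" for j
  proof -
    have [measurable]: "(\<lambda>\<omega>. Z t \<omega> j) \<in> borel_measurable R" using Suc that by simp
    moreover from this have [measurable]: "(\<lambda>\<omega>. N t \<omega> j) \<in> borel_measurable R"
      using Suc that by (intro noise_meas) auto
    ultimately show ?thesis unfolding W_def using that by measurable
  qed
  show ?case unfolding Z_Suc using Suc.prems(2) by (cases "\<tau> dvd Suc t") auto
qed

lemma Z_history_meas: "j < n \<Longrightarrow> (\<lambda>\<omega>. Z t \<omega> j) \<in> borel_measurable (history t i)"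
  by (intro Z_meas \<xi>_history_meas) (auto simp: others_def)

lemma noise_history_meas: "j < n \<Longrightarrow> j \<noteq> i \<Longrightarrow> (\<lambda>\<omega>. N t \<omega> j) \<in> borel_measurable (history t i)"
  by (intro noise_meas Z_history_meas \<xi>_history_meas) (auto simp: others_def)

text \<open>The iterate is determined by \<open>history t i\<close>, of which
  \<open>\<xi> t i\<close> is independent, so \<open>noise_moments\<close> applies. Conditional mean
  zero is expressed as orthogonality to every square integrable \<open>u\<close> measurable for the
  history.\<close>

lemma
  assumes i: "i < n"
  shows noise_sq: "square_integrable M (\<lambda>\<omega>. N t \<omega> i)"
    and noise_var: "expectation (\<lambda>\<omega>. (norm (N t \<omega> i))\<^sup>2) \<le> \<sigma>\<^sup>2"
    and noise_orth: "u \<in> borel_measurable (history t i) \<Longrightarrow> square_integrable M u \<Longrightarrow>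
      expectation (\<lambda>\<omega>. inner (u \<omega>) (N t \<omega> i)) = 0"
proof -
  interpret Di: prob_space "D i" using i by (rule prob_space_D)
  have meas: "(\<lambda>(z, s). G i z s - Fi i z) \<in> borel_measurable (borel \<Otimes>\<^sub>M D i)"
    using G_meas[OF i] Fi_meas[OF i] by (simp add: case_prod_beta) measurable
  have int: "integrable (D i) (\<lambda>s. G i z s - Fi i z)" for z
    using G_int[OF i] by simp
  have mean: "(LINT s|D i. G i z s - Fi i z) = 0" for z
    using G_int[OF i] G_mean[OF i] by (simp add: Di.prob_space)
  have *: "square_integrable M (\<lambda>\<omega>. N t \<omega> i) \<and> expectation (\<lambda>\<omega>. (norm (N t \<omega> i))\<^sup>2) \<le> \<sigma>\<^sup>2
      \<and> expectation (\<lambda>\<omega>. inner (u \<omega>) (N t \<omega> i)) = 0"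
    if u: "u \<in> borel_measurable (history t i)" "square_integrable M u" for u
  proof -
    note moments = noise_moments[where F = "history t i" and z = "\<lambda>\<omega>. Z t \<omega> i" and u = u
        and Y = "\<xi> t i" and D = "D i" and N = "\<lambda>z s. G i z s - Fi i z" and v = "\<sigma>\<^sup>2",
        OF space_history sets_history_subset Z_history_meas[OF i] u(1) \<xi>_meas[OF i] \<xi>_law[OF i]
          history_indep[OF i] meas int mean G_sq_int[OF i] G_var[OF i] u(2)]
    show ?thesis unfolding N_def by (intro conjI moments)
  qed
  from *[of "\<lambda>_. 0"] show "square_integrable M (\<lambda>\<omega>. N t \<omega> i)"
    and "expectation (\<lambda>\<omega>. (norm (N t \<omega> i))\<^sup>2) \<le> \<sigma>\<^sup>2"
    by (auto simp: square_integrable_const)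
  from * show "u \<in> borel_measurable (history t i) \<Longrightarrow> square_integrable M u \<Longrightarrow>
      expectation (\<lambda>\<omega>. inner (u \<omega>) (N t \<omega> i)) = 0" by blast
qed

text \<open>The induction is not circular: \<open>noise_sq\<close> needs only measurability of the
  iterate, since the variance bound is uniform in the point.\<close>

lemma Z_sq: "i < n \<Longrightarrow> square_integrable M (\<lambda>\<omega>. Z t \<omega> i)"
proof (induction t arbitrary: i)
  case 0
  then show ?case by (simp add: Z_0 square_integrable_const)
next
  case (Suc t)
  have "square_integrable M (\<lambda>\<omega>. W t \<omega> j)" if "j < n" for j
    unfolding W_def
    by (intro square_integrable_add square_integrable_linear[OF bounded_linear_sgda_step] Suc.IH noise_sq that
        square_integrable_lipschitz[OF Suc.IH Fi_lip])
  then show ?case unfolding Z_Suc using Suc.prems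
    by (cases "\<tau> dvd Suc t") (auto intro!: square_integrable_scaleR square_integrable_sum)
qed

lemma zbar_sq: "square_integrable M (zbar t)"
  unfolding zbar_def by (intro square_integrable_scaleR square_integrable_sum Z_sq) auto

lemma ebar_sq: "square_integrable M (ebar t)"
  unfolding ebar_def by (intro square_integrable_scaleR square_integrable_sum noise_sq) auto

lemma zbar_history_meas: "zbar t \<in> borel_measurable (history t i)"
  unfolding zbar_def using Z_history_meas by measurable

text \<open>The averaged noise involves all clients, so \<open>u\<close> must be measurable for each
  \<open>history t i\<close>. Functions of \<open>zbar t\<close> qualify, as they depend only on
  samples before time \<open>t\<close>.\<close>

lemma ebar_orth:
  assumes "\<And>i. u \<in> borel_measurable (history t i)" "square_integrable M u"
  shows "expectation (\<lambda>\<omega>. inner (u \<omega>) (ebar t \<omega>)) = 0"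
proof -
  have "expectation (\<lambda>\<omega>. inner (u \<omega>) (ebar t \<omega>))
      = expectation (\<lambda>\<omega>. (1 / real n) * (\<Sum>i<n. inner (u \<omega>) (N t \<omega> i)))"
    by (simp add: ebar_def inner_sum_right)
  also have "\<dots> = (1 / real n) * (\<Sum>i<n. expectation (\<lambda>\<omega>. inner (u \<omega>) (N t \<omega> i)))"
    using assms(2) by (subst Bochner_Integration.integral_sum[symmetric])
      (auto intro: square_integrable_inner noise_sq)
  also have "\<dots> = 0" using noise_orth assms by simp
  finally show ?thesis .
qed

text \<open>For \<open>i \<noteq> j\<close> the noise of client \<open>i\<close> is measurable for
  \<open>history t j\<close>, so of the \<open>n\<^sup>2\<close> products only the \<open>n\<close>
  diagonal ones contribute. The resulting \<open>1 / n\<close> is the source of the speedup in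
  \<open>T\<close>.\<close>

lemma ebar_var: "expectation (\<lambda>\<omega>. (norm (ebar t \<omega>))\<^sup>2) \<le> \<sigma>\<^sup>2 / real n"
proof -
  have int: "integrable M (\<lambda>\<omega>. inner (N t \<omega> i) (N t \<omega> j))" if "i < n" "j < n" for i j
    using that by (intro square_integrable_inner noise_sq)
  have cross: "expectation (\<lambda>\<omega>. inner (N t \<omega> i) (N t \<omega> j)) \<le> (if i = j then \<sigma>\<^sup>2 else 0)"
    if "i < n" "j < n" for i j
    using that noise_var[of i t] noise_orth[OF that(2) noise_history_meas[OF that(1)] noise_sq[OF that(1)]]
    by (auto simp: power2_norm_eq_inner)
  have "(norm (ebar t \<omega>))\<^sup>2 = (\<Sum>i<n. \<Sum>j<n. inner (N t \<omega> i) (N t \<omega> j)) / (real n)\<^sup>2" for \<omega>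
  proof -
    have "(norm (ebar t \<omega>))\<^sup>2 = inner (\<Sum>i<n. N t \<omega> i) (\<Sum>j<n. N t \<omega> j) / (real n)\<^sup>2"
      by (simp add: ebar_def power_divide flip: power2_norm_eq_inner)
    then show ?thesis by (subst sum.swap) (simp only: inner_sum_left inner_sum_right)
  qed
  then have "expectation (\<lambda>\<omega>. (norm (ebar t \<omega>))\<^sup>2)
      = expectation (\<lambda>\<omega>. (\<Sum>i<n. \<Sum>j<n. inner (N t \<omega> i) (N t \<omega> j)) / (real n)\<^sup>2)"
    by simp
  also have "\<dots> = (\<Sum>i<n. \<Sum>j<n. expectation (\<lambda>\<omega>. inner (N t \<omega> i) (N t \<omega> j))) / (real n)\<^sup>2"
  proof -
    have "expectation (\<lambda>\<omega>. \<Sum>i<n. \<Sum>j<n. inner (N t \<omega> i) (N t \<omega> j))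
        = (\<Sum>i<n. expectation (\<lambda>\<omega>. \<Sum>j<n. inner (N t \<omega> i) (N t \<omega> j)))"
      by (intro Bochner_Integration.integral_sum Bochner_Integration.integrable_sum int) auto
    also have "\<dots> = (\<Sum>i<n. \<Sum>j<n. expectation (\<lambda>\<omega>. inner (N t \<omega> i) (N t \<omega> j)))"
      by (intro sum.cong refl Bochner_Integration.integral_sum int) auto
    finally show ?thesis by simp
  qed
  also have "\<dots> \<le> (\<Sum>i<n. \<Sum>j<n. if i = j then \<sigma>\<^sup>2 else 0) / (real n)\<^sup>2"
    using cross by (intro divide_right_mono sum_mono) auto
  also have "\<dots> = \<sigma>\<^sup>2 / real n" by (simp add: power2_eq_square)
  finally show ?thesis .
qed

section \<open>Expected deviation between synchronisations\<close>

lemma dev_int: "integrable M (dev t)"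
  unfolding dev_def
  by (intro integrable_divide Bochner_Integration.integrable_sum square_integrableD
      square_integrable_diff Z_sq zbar_sq) auto

definition "S = \<sigma>\<^sup>2 + H"

lemma
  shows spread_int: "integrable M (spread t)"
    and spread_le: "expectation (spread t) \<le> 3 * S + 3 * L\<^sup>2 * expectation (dev t)"
proof -
  have int: "integrable M (\<lambda>\<omega>. (norm (N t \<omega> i))\<^sup>2)" if "i < n" for i
    using that by (intro square_integrableD noise_sq)
  define A where "A \<omega> = (\<Sum>i<n. (norm (N t \<omega> i))\<^sup>2) / real n" for \<omega>
  have A: "integrable M A"
    unfolding A_def by (intro integrable_divide Bochner_Integration.integrable_sum int) auto
  have spread: "spread t = (\<lambda>\<omega>. 3 * A \<omega> + 3 * L\<^sup>2 * dev t \<omega> + 3 * H)"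
    by (simp add: spread_def[abs_def] A_def)
  show "integrable M (spread t)"
    unfolding spread using A dev_int by simp
  have "expectation A = (\<Sum>i<n. expectation (\<lambda>\<omega>. (norm (N t \<omega> i))\<^sup>2)) / real n"
    unfolding A_def using int by simp
  also have "\<dots> \<le> (\<Sum>i<n. \<sigma>\<^sup>2) / real n"
    using noise_var by (intro divide_right_mono sum_mono) auto
  also have "\<dots> = \<sigma>\<^sup>2" using n_ge_1 by simp
  finally have "expectation A \<le> \<sigma>\<^sup>2" .
  moreover have "expectation (spread t) = 3 * expectation A + 3 * L\<^sup>2 * expectation (dev t) + 3 * H"
    unfolding spread using A dev_int by (simp add: prob_space)
  ultimately show "expectation (spread t) \<le> 3 * S + 3 * L\<^sup>2 * expectation (dev t)"
    by (simp add: S_def)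
qed

text \<open>Since the last synchronisation the root mean square deviation grows by a bounded amount per
  step; the weights \<open>1 + 1 / r\<close> and \<open>1 + r\<close> turn \<open>r\<^sup>2\<close> into \<open>(r + 1)\<^sup>2\<close>.\<close>
lemma dev_le:
  assumes small: "6 * (real \<tau>)\<^sup>2 * hy\<^sup>2 * L\<^sup>2 \<le> 1" and "0 \<le> H"
  shows "expectation (dev t) \<le> (real (t mod \<tau>))\<^sup>2 * (6 * hy\<^sup>2 * S)"
proof (induction t)
  case 0
  then show ?case by (simp add: dev_sync)
next
  case (Suc t)
  show ?case
  proof (cases "\<tau> dvd Suc t")
    case True
    then show ?thesis by (simp add: dev_sync)
  next
    case False
    define r where "r = t mod \<tau>"
    have r: "r < \<tau>" and Suc_r: "Suc t mod \<tau> = Suc r"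
      using False tau_ge_1 by (auto simp: r_def mod_Suc dvd_eq_mod_eq_0)
    have S: "0 \<le> S" using \<open>0 \<le> H\<close> by (simp add: S_def)
    \<comment> \<open>By the induction hypothesis and \<open>small\<close>, \<open>L\<^sup>2\<close>
      times the deviation is at most \<open>S\<close>; drift thus raises the bound on the spread
      from \<open>3 * S\<close> to no more than \<open>6 * S\<close>.\<close>
    have "(real r)\<^sup>2 * (6 * hy\<^sup>2 * S) \<le> (real \<tau>)\<^sup>2 * (6 * hy\<^sup>2 * S)"
      using r S by (intro mult_right_mono power_mono) auto
    with Suc.IH have "L\<^sup>2 * expectation (dev t) \<le> L\<^sup>2 * ((real \<tau>)\<^sup>2 * (6 * hy\<^sup>2 * S))"
      by (intro mult_left_mono) (auto simp: r_def)
    also have "\<dots> = (6 * (real \<tau>)\<^sup>2 * hy\<^sup>2 * L\<^sup>2) * S" by (simp add: mult_ac)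
    also have "\<dots> \<le> 1 * S" using small S by (rule mult_right_mono)
    finally have sp: "expectation (spread t) \<le> 6 * S" using spread_le[of t] by simp
    have sp': "hy\<^sup>2 * expectation (spread t) \<le> 6 * hy\<^sup>2 * S"
      using mult_left_mono[OF sp, of "hy\<^sup>2"] by (simp add: mult_ac)
    show ?thesis
    proof (cases "r = 0")
      case True
      then have "\<tau> dvd t" by (simp add: r_def dvd_eq_mod_eq_0)
      then have "dev (Suc t) \<omega> \<le> hy\<^sup>2 * spread t \<omega>" for \<omega>
        using dev_Suc(2)[OF False] dev_sync by blast
      then have "expectation (dev (Suc t)) \<le> expectation (\<lambda>\<omega>. hy\<^sup>2 * spread t \<omega>)"
        using dev_int spread_int by (intro integral_mono) auto
      then show ?thesis using sp' True unfolding Suc_r by simp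
    next
      case False
      then have r0: "real r > 0" by simp
      have "dev (Suc t) \<omega> \<le> (1 + 1 / real r) * dev t \<omega> + (1 + real r) * (hy\<^sup>2 * spread t \<omega>)" for \<omega>
        using dev_Suc(1)[OF \<open>\<not> \<tau> dvd Suc t\<close> r0] .
      then have "expectation (dev (Suc t))
          \<le> expectation (\<lambda>\<omega>. (1 + 1 / real r) * dev t \<omega> + (1 + real r) * (hy\<^sup>2 * spread t \<omega>))"
        using dev_int spread_int by (intro integral_mono) auto
      also have "\<dots> = (1 + 1 / real r) * expectation (dev t) + (1 + real r) * (hy\<^sup>2 * expectation (spread t))"
        using dev_int spread_int by simp
      also have "\<dots> \<le> (1 + 1 / real r) * ((real r)\<^sup>2 * (6 * hy\<^sup>2 * S)) + (1 + real r) * (6 * hy\<^sup>2 * S)"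
        using Suc.IH sp' r0 by (intro add_mono mult_left_mono) (auto simp: r_def)
      also have "\<dots> = (real (Suc r))\<^sup>2 * (6 * hy\<^sup>2 * S)"
        using r0 by (simp add: field_simps power2_eq_square)
      finally show ?thesis unfolding Suc_r .
    qed
  qed
qed

end

section \<open>Expected stationarity\<close>

text \<open>The pointwise bound \<open>h \<le> h\<^sup>2 / (2 * \<epsilon>) + \<epsilon> / 2\<close>
  passes from mean squares to the mean norm, and is sharp at \<open>h = \<epsilon>\<close>.\<close>

lemma expected_stationaryI:
  fixes X :: "nat \<Rightarrow> 'w \<Rightarrow> 'a::euclidean_space"
  assumes "prob_space M" and diff: "\<And>x. \<Phi> differentiable (at x)" and "T \<ge> 1" "\<epsilon> > 0"
    and sq: "\<And>t. square_integrable M (\<lambda>\<omega>. gradient \<Phi> (X t \<omega>))"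
    and avg: "(\<Sum>t<T. LINT \<omega>|M. (norm (gradient \<Phi> (X t \<omega>)))\<^sup>2) \<le> real T * \<epsilon>\<^sup>2"
  shows "expected_stationary \<Phi> M X T \<epsilon>"
proof -
  interpret prob_space M by fact
  define U where "U = measure_pmf (pmf_of_set {..<T})"
  have T: "{..<T} \<noteq> {}" "finite {..<T}" using \<open>T \<ge> 1\<close> by (auto simp: lessThan_empty_iff)
  interpret U: prob_space U unfolding U_def by (rule measure_pmf.prob_space_axioms)
  interpret P: pair_prob_space M U ..
  define h where "h t \<omega> = norm (gradient \<Phi> (X t \<omega>))" for t \<omega>
  have h_meas [measurable]: "h t \<in> borel_measurable M" for t
    using sq[of t] unfolding h_def[abs_def] by measurable
  have h_int: "integrable M (h t)" for t
    unfolding h_def[abs_def] using sq by (rule square_integrable_imp_integrable_norm)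
  have h2_int: "integrable M (\<lambda>\<omega>. (h t \<omega>)\<^sup>2)" for t
    unfolding h_def[abs_def] using sq by (rule square_integrableD)
  have [measurable]: "(\<lambda>(\<omega>, t). h t \<omega>) \<in> borel_measurable (M \<Otimes>\<^sub>M U)"
  proof -
    \<comment> \<open>Joint measurability reduces to measurability in \<open>\<omega>\<close> for
      each fixed \<open>t\<close>, because \<open>t\<close> ranges over a countable set.\<close>
    have "snd \<in> measurable (M \<Otimes>\<^sub>M U) (count_space UNIV)" unfolding U_def by measurable
    then have "(\<lambda>p. h (snd p) (fst p)) \<in> borel_measurable (M \<Otimes>\<^sub>M U)"
      by (rule measurable_compose_countable[rotated]) measurable
    then show ?thesis by (simp add: case_prod_beta')
  qed
  have inner: "(LINT t|U. h t \<omega>) = (\<Sum>t<T. h t \<omega>) / real T" for \<omega>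
    unfolding U_def using T by (simp add: integral_pmf_of_set)
  have "integrable (M \<Otimes>\<^sub>M U) (\<lambda>(\<omega>, t). h t \<omega>)"
  proof (rule P.Fubini_integrable)
    have "norm (h t \<omega>) = h t \<omega>" for t \<omega> by (simp add: h_def)
    then show "integrable M (\<lambda>\<omega>. LINT t|U. norm (case (\<omega>, t) of (\<omega>, t) \<Rightarrow> h t \<omega>))"
      using h_int by (simp add: inner)
    show "AE \<omega> in M. integrable U (\<lambda>t. case (\<omega>, t) of (\<omega>, t) \<Rightarrow> h t \<omega>)"
      unfolding U_def using T by (intro AE_I2 integrable_measure_pmf_finite) simp
  qed measurable
  then have int: "integrable (M \<Otimes>\<^sub>M U) (\<lambda>(\<omega>, t). h t \<omega>)" .
  have "(LINT (\<omega>, t)|(M \<Otimes>\<^sub>M U). h t \<omega>) = (LINT \<omega>|M. LINT t|U. h t \<omega>)"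
    using P.integral_fst'[OF int] by simp
  also have "\<dots> = (\<Sum>t<T. LINT \<omega>|M. h t \<omega>) / real T"
    using h_int by (simp add: inner)
  also have "(\<Sum>t<T. LINT \<omega>|M. h t \<omega>) \<le> (\<Sum>t<T. (LINT \<omega>|M. (h t \<omega>)\<^sup>2) / (2 * \<epsilon>) + \<epsilon> / 2)"
  proof (rule sum_mono)
    fix t
    have "h t \<omega> \<le> (h t \<omega>)\<^sup>2 / (2 * \<epsilon>) + \<epsilon> / 2" for \<omega>
    proof -
      have "2 * h t \<omega> * \<epsilon> \<le> (h t \<omega>)\<^sup>2 + \<epsilon>\<^sup>2" by (rule sum_squares_bound)
      then show ?thesis using \<open>\<epsilon> > 0\<close> by (simp add: field_simps power2_eq_square)
    qed
    then have "(LINT \<omega>|M. h t \<omega>) \<le> (LINT \<omega>|M. (h t \<omega>)\<^sup>2 / (2 * \<epsilon>) + \<epsilon> / 2)"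
      using h_int h2_int by (intro integral_mono) auto
    also have "\<dots> = (LINT \<omega>|M. (h t \<omega>)\<^sup>2) / (2 * \<epsilon>) + \<epsilon> / 2"
      using h2_int by (simp add: prob_space)
    finally show "(LINT \<omega>|M. h t \<omega>) \<le> (LINT \<omega>|M. (h t \<omega>)\<^sup>2) / (2 * \<epsilon>) + \<epsilon> / 2" .
  qed
  also have "(\<Sum>t<T. (LINT \<omega>|M. (h t \<omega>)\<^sup>2) / (2 * \<epsilon>) + \<epsilon> / 2)
      = (\<Sum>t<T. LINT \<omega>|M. (h t \<omega>)\<^sup>2) / (2 * \<epsilon>) + real T * (\<epsilon> / 2)"
    by (simp add: sum.distrib sum_divide_distrib)
  also have "(\<Sum>t<T. LINT \<omega>|M. (h t \<omega>)\<^sup>2) / (2 * \<epsilon>) \<le> (real T * \<epsilon>\<^sup>2) / (2 * \<epsilon>)"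
    using avg \<open>\<epsilon> > 0\<close> by (intro divide_right_mono) (auto simp: h_def)
  finally have "(LINT (\<omega>, t)|(M \<Otimes>\<^sub>M U). h t \<omega>) \<le> ((real T * \<epsilon>\<^sup>2) / (2 * \<epsilon>) + real T * (\<epsilon> / 2)) / real T"
    using \<open>T \<ge> 1\<close> by (simp add: divide_right_mono)
  also have "\<dots> = \<epsilon>" using \<open>T \<ge> 1\<close> \<open>\<epsilon> > 0\<close> by (simp add: field_simps power2_eq_square)
  finally show ?thesis
    using int diff unfolding expected_stationary_def U_def h_def Let_def by simp
qed

section \<open>Expected descent along the averaged iterates\<close>

locale sgda_pl = sgda_run M n \<tau> D G Fi F \<xi> hx hy L \<sigma> H x0 y0 + pl_problem f F L \<mu>
  for M :: "'w measure" and n \<tau> :: nat and D :: "nat \<Rightarrow> 's measure"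
    and G :: "nat \<Rightarrow> 'a::euclidean_space \<times> 'b::euclidean_space \<Rightarrow> 's \<Rightarrow> 'a \<times> 'b"
    and Fi F \<xi> hx hy L \<sigma> H x0 y0 f \<mu>
begin

lemma F_meas: "F \<in> borel_measurable borel"
  using lip by (rule borel_measurable_lipschitz)

lemma g_meas: "g \<in> borel_measurable borel"
  using grad_primal_lipschitz by (rule borel_measurable_lipschitz)

lemma lyapunov_int: "integrable M (\<lambda>\<omega>. lyapunov (zbar t \<omega>))"
proof -
  have cont: "\<phi> \<in> borel_measurable borel" if "\<And>x. GDERIV \<phi> x :> \<gamma> x" for \<phi> :: "'z::euclidean_space \<Rightarrow> real" and \<gamma>
    using that unfolding gderiv_def
    by (intro borel_measurable_continuous_onI continuous_at_imp_continuous_on ballI)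
      (blast intro: has_derivative_continuous)
  have "integrable M (\<lambda>\<omega>. f (zbar t \<omega>))"
    using taylor[of _ 0] cont[OF grad]
    by (intro integrable_quadratic_growth[where v = "F 0" and B = L] zbar_sq finite_measure_axioms) auto
  moreover have "integrable M (\<lambda>\<omega>. \<Phi> (fst (zbar t \<omega>)))"
    using primal_quadratic[of _ 0] cont[OF GDERIV_primal]
    by (intro integrable_quadratic_growth[where v = "g 0" and B = "3 / 2 * (L * \<kappa>)"]
        square_integrable_linear[OF bounded_linear_fst] zbar_sq finite_measure_axioms) auto
  ultimately show ?thesis unfolding lyapunov_def by simp
qed

lemma grad_sq: "square_integrable M (\<lambda>\<omega>. g (fst (zbar t \<omega>)))"
  using grad_primal_lipschitz
  by (rule square_integrable_lipschitz[OF square_integrable_linear[OF bounded_linear_fst zbar_sq]])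

lemma noise_coeff_inner:
  "integrable M (\<lambda>\<omega>. inner (noise_coeff hx hy (zbar t \<omega>)) (ebar t \<omega>))"
  "expectation (\<lambda>\<omega>. inner (noise_coeff hx hy (zbar t \<omega>)) (ebar t \<omega>)) = 0"
proof -
  have "continuous_on UNIV (fst :: 'a \<times> 'b \<Rightarrow> 'a)" "continuous_on UNIV (snd :: 'a \<times> 'b \<Rightarrow> 'b)"
    by (intro continuous_intros)+
  note [measurable] = F_meas g_meas this[THEN borel_measurable_continuous_onI]
  have "noise_coeff hx hy \<in> borel_measurable borel"
    unfolding noise_coeff_def[abs_def] by measurable
  then have meas: "(\<lambda>\<omega>. noise_coeff hx hy (zbar t \<omega>)) \<in> borel_measurable R"
    if "zbar t \<in> borel_measurable R" for R :: "'w measure"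
    using measurable_compose[OF that] by blast
  have Fsq: "square_integrable M (\<lambda>\<omega>. F (zbar t \<omega>))"
    by (rule square_integrable_lipschitz[OF zbar_sq lip])
  have P: "square_integrable M (\<lambda>\<omega>. (u \<omega>, v \<omega>))" if "square_integrable M u" "square_integrable M v"
    for u :: "'w \<Rightarrow> 'a" and v :: "'w \<Rightarrow> 'b"
    using that by (auto simp: square_integrable_def norm_Pair borel_measurable_Pair)
  have "square_integrable M (\<lambda>\<omega>. noise_coeff hx hy (zbar t \<omega>))"
    unfolding noise_coeff_def
    by (intro P square_integrable_add square_integrable_scaleR grad_sq
        square_integrable_linear[OF bounded_linear_fst Fsq] square_integrable_linear[OF bounded_linear_snd Fsq])
  then show "integrable M (\<lambda>\<omega>. inner (noise_coeff hx hy (zbar t \<omega>)) (ebar t \<omega>))"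
    "expectation (\<lambda>\<omega>. inner (noise_coeff hx hy (zbar t \<omega>)) (ebar t \<omega>)) = 0"
    using meas[OF zbar_history_meas] by (auto intro: square_integrable_inner ebar_sq ebar_orth)
qed

text \<open>In expectation the linear noise term disappears and the quadratic one costs only
  \<open>\<sigma>\<^sup>2 / n\<close>.\<close>

lemma expected_descent:
  assumes hy: "hy > 0" "L * hy \<le> 1 / 4" and hx_eq: "hx = hy / (48 * \<kappa>\<^sup>2)"
  shows "expectation (\<lambda>\<omega>. lyapunov (zbar (Suc t) \<omega>)) \<le> expectation (\<lambda>\<omega>. lyapunov (zbar t \<omega>))
     - hx / 2 * expectation (\<lambda>\<omega>. (norm (g (fst (zbar t \<omega>))))\<^sup>2)
     + hy * L\<^sup>2 / 8 * expectation (dev t) + L * hy\<^sup>2 / 2 * (\<sigma>\<^sup>2 / real n)"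
proof -
  have e_int: "integrable M (\<lambda>\<omega>. (norm (ebar t \<omega>))\<^sup>2)" by (intro square_integrableD ebar_sq)
  have g_int: "integrable M (\<lambda>\<omega>. (norm (g (fst (zbar t \<omega>))))\<^sup>2)" by (intro square_integrableD grad_sq)
  have "lyapunov (zbar (Suc t) \<omega>) \<le> lyapunov (zbar t \<omega>) - hx / 2 * (norm (g (fst (zbar t \<omega>))))\<^sup>2
     + inner (noise_coeff hx hy (zbar t \<omega>)) (ebar t \<omega>) + hy * L\<^sup>2 / 8 * dev t \<omega>
     + L * hy\<^sup>2 / 2 * (norm (ebar t \<omega>))\<^sup>2" for \<omega>
    unfolding zbar_Suc by (rule lyapunov_step[OF hy hx_eq vbar_error])
  then have "expectation (\<lambda>\<omega>. lyapunov (zbar (Suc t) \<omega>))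
      \<le> expectation (\<lambda>\<omega>. lyapunov (zbar t \<omega>) - hx / 2 * (norm (g (fst (zbar t \<omega>))))\<^sup>2
     + inner (noise_coeff hx hy (zbar t \<omega>)) (ebar t \<omega>) + hy * L\<^sup>2 / 8 * dev t \<omega>
     + L * hy\<^sup>2 / 2 * (norm (ebar t \<omega>))\<^sup>2)"
    using lyapunov_int noise_coeff_inner(1) e_int g_int dev_int
    by (intro integral_mono) (auto intro!: Bochner_Integration.integrable_add Bochner_Integration.integrable_diff integrable_mult_right)
  also have "\<dots> = expectation (\<lambda>\<omega>. lyapunov (zbar t \<omega>))
     - hx / 2 * expectation (\<lambda>\<omega>. (norm (g (fst (zbar t \<omega>))))\<^sup>2)
     + hy * L\<^sup>2 / 8 * expectation (dev t) + L * hy\<^sup>2 / 2 * expectation (\<lambda>\<omega>. (norm (ebar t \<omega>))\<^sup>2)"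
    using lyapunov_int[of t] noise_coeff_inner[of t] e_int g_int dev_int[of t] by simp
  also have "\<dots> \<le> expectation (\<lambda>\<omega>. lyapunov (zbar t \<omega>))
     - hx / 2 * expectation (\<lambda>\<omega>. (norm (g (fst (zbar t \<omega>))))\<^sup>2)
     + hy * L\<^sup>2 / 8 * expectation (dev t) + L * hy\<^sup>2 / 2 * (\<sigma>\<^sup>2 / real n)"
    using ebar_var[of t] L_pos by (intro add_left_mono mult_left_mono) auto
  finally show ?thesis .
qed

text \<open>\<open>expected_descent\<close> telescopes. The final value is bounded below by
  \<open>m\<close>, because \<open>f \<le> \<Phi>\<close> implies that \<open>lyapunov\<close>
  dominates \<open>\<Phi>\<close>.\<close>

lemma sum_grad_le:
  assumes hy: "hy > 0" "L * hy \<le> 1 / 4" and hx_eq: "hx = hy / (48 * \<kappa>\<^sup>2)"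
    and small: "6 * (real \<tau>)\<^sup>2 * hy\<^sup>2 * L\<^sup>2 \<le> 1" and "0 \<le> H" and lb: "\<And>x. m \<le> \<Phi> x"
  shows "hx / 2 * (\<Sum>t<T. expectation (\<lambda>\<omega>. (norm (g (fst (zbar t \<omega>))))\<^sup>2))
    \<le> \<Phi> x0 - m + (\<Phi> x0 - f (x0, y0)) / 4
      + real T * (hy * L\<^sup>2 / 8 * ((real \<tau>)\<^sup>2 * (6 * hy\<^sup>2 * S)) + L * hy\<^sup>2 / 2 * (\<sigma>\<^sup>2 / real n))"
proof -
  define c1 c2 where "c1 = hy * L\<^sup>2 / 8 * ((real \<tau>)\<^sup>2 * (6 * hy\<^sup>2 * S))"
    and "c2 = L * hy\<^sup>2 / 2 * (\<sigma>\<^sup>2 / real n)"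
  let ?e = "\<lambda>t. expectation (\<lambda>\<omega>. (norm (g (fst (zbar t \<omega>))))\<^sup>2)"
  let ?l = "\<lambda>t. expectation (\<lambda>\<omega>. lyapunov (zbar t \<omega>))"
  have S: "0 \<le> S" using \<open>0 \<le> H\<close> by (simp add: S_def)
  have "hx / 2 * (\<Sum>t<T. ?e t) \<le> ?l 0 - ?l T + real T * (c1 + c2)"
  proof (induction T)
    case (Suc T)
    have "expectation (dev T) \<le> (real (T mod \<tau>))\<^sup>2 * (6 * hy\<^sup>2 * S)"
      by (rule dev_le[OF small \<open>0 \<le> H\<close>])
    also have "\<dots> \<le> (real \<tau>)\<^sup>2 * (6 * hy\<^sup>2 * S)"
      using S tau_ge_1 by (intro mult_right_mono power_mono) (auto simp: less_imp_le)
    finally have "hy * L\<^sup>2 / 8 * expectation (dev T) \<le> c1"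
      unfolding c1_def using hy by (intro mult_left_mono) auto
    then have "?l (Suc T) \<le> ?l T - hx / 2 * ?e T + c1 + c2"
      using expected_descent[OF hy hx_eq, of T] unfolding c2_def by linarith
    moreover have "hx / 2 * (\<Sum>t<Suc T. ?e t) = hx / 2 * (\<Sum>t<T. ?e t) + hx / 2 * ?e T"
      by (simp add: distrib_left)
    moreover have "real (Suc T) * (c1 + c2) = real T * (c1 + c2) + c1 + c2"
      by (simp add: algebra_simps)
    ultimately show ?case using Suc by linarith
  qed simp
  moreover have "?l 0 = \<Phi> x0 + (\<Phi> x0 - f (x0, y0)) / 4"
  proof -
    have "zbar 0 \<omega> = (x0, y0)" for \<omega> using n_ge_1 by (simp add: zbar_def Z_0 sum_constant_scaleR)
    then show ?thesis by (simp add: lyapunov_def prob_space field_simps)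
  qed
  moreover have "m \<le> ?l T"
  proof -
    have "m \<le> lyapunov z" for z
      using lb[of "fst z"] le_primal[of "fst z" "snd z"] by (simp add: lyapunov_def)
    then have "expectation (\<lambda>_. m) \<le> ?l T" using lyapunov_int by (intro integral_mono) auto
    then show ?thesis by (simp add: prob_space)
  qed
  ultimately show ?thesis unfolding c1_def c2_def by linarith
qed

lemma sgda_expected_stationary:
  assumes hy: "hy > 0" "L * hy \<le> 1 / 4" and hx_eq: "hx = hy / (48 * \<kappa>\<^sup>2)"
    and small: "6 * (real \<tau>)\<^sup>2 * hy\<^sup>2 * L\<^sup>2 \<le> 1" and "0 \<le> H" and lb: "\<And>x. m \<le> \<Phi> x"
    and T: "T \<ge> 1" and \<epsilon>: "\<epsilon> > 0"
    and budget: "\<Phi> x0 - m + (\<Phi> x0 - f (x0, y0)) / 4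
      + real T * (hy * L\<^sup>2 / 8 * ((real \<tau>)\<^sup>2 * (6 * hy\<^sup>2 * S)) + L * hy\<^sup>2 / 2 * (\<sigma>\<^sup>2 / real n))
      \<le> hx / 2 * (real T * \<epsilon>\<^sup>2)"
  shows "expected_stationary \<Phi> M
      (\<lambda>t \<omega>. avg_iterate n G hx hy \<tau> x0 y0 (\<lambda>k i. \<xi> k i \<omega>) t) T \<epsilon>"
proof -
  have avg: "avg_iterate n G hx hy \<tau> x0 y0 (\<lambda>k i. \<xi> k i \<omega>) t = fst (zbar t \<omega>)" for t \<omega>
    by (simp add: avg_iterate_def zbar_def Z_def fst_sum)
  have gr: "gradient \<Phi> x = g x" for x by (rule gradient_eqI) (rule GDERIV_primal)
  have diff: "\<Phi> differentiable (at x)" for x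
    using GDERIV_primal[of x] unfolding gderiv_def by (rule differentiableI)
  have "hx / 2 * (\<Sum>t<T. expectation (\<lambda>\<omega>. (norm (g (fst (zbar t \<omega>))))\<^sup>2)) \<le> hx / 2 * (real T * \<epsilon>\<^sup>2)"
    using sum_grad_le[OF hy hx_eq small \<open>0 \<le> H\<close> lb, of T] budget by linarith
  moreover have "hx > 0" using hy kappa_ge_1 by (simp add: hx_eq)
  ultimately have "(\<Sum>t<T. expectation (\<lambda>\<omega>. (norm (g (fst (zbar t \<omega>))))\<^sup>2)) \<le> real T * \<epsilon>\<^sup>2"
    by simp
  then show ?thesis
    by (intro expected_stationaryI T \<epsilon>) (simp_all add: avg gr diff grad_sq prob_space_axioms)
qed

end

section \<open>Reduction of the stated assumptions to the abstract setting\<close>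

lemma gradient_global_loss:
  fixes f :: "nat \<Rightarrow> 'z::euclidean_space \<Rightarrow> real"
  assumes "\<And>i. i < n \<Longrightarrow> f i differentiable (at z)"
  shows "GDERIV (global_loss n f) z :> (1 / real n) *\<^sub>R (\<Sum>i<n. gradient (f i) z)"
proof -
  have "((\<lambda>z. (1 / real n) * (\<Sum>i<n. f i z)) has_derivative
      (\<lambda>h. (1 / real n) * (\<Sum>i<n. inner h (gradient (f i) z)))) (at z)"
    using assms GDERIV_gradient
    by (intro has_derivative_mult_right has_derivative_sum) (auto simp: gderiv_def)
  then show ?thesis
    by (simp add: gderiv_def global_loss_def[abs_def] inner_sum_right)
qed

text \<open>The squared product norm splits into components, so \<open>H\<close> becomes
  \<open>\<zeta>\<^sub>x\<^sup>2 + \<zeta>\<^sub>y\<^sup>2\<close>. The budget uses absolute values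
  because the bounds on the initial gaps are fixed in advance, with no sign prescribed.\<close>

lemma local_sgda_expected_stationary:
  fixes M :: "'w measure" and D :: "nat \<Rightarrow> 's measure"
    and G :: "nat \<Rightarrow> 'a::euclidean_space \<times> 'b::euclidean_space \<Rightarrow> 's \<Rightarrow> 'a \<times> 'b"
    and \<xi> :: "nat \<Rightarrow> nat \<Rightarrow> 'w \<Rightarrow> 's" and f\<^sub>l :: "nat \<Rightarrow> 'a \<times> 'b \<Rightarrow> real"
  assumes "n \<ge> 1" "\<tau> \<ge> 1" "L > 0" "\<mu> > 0" "\<mu> \<le> L"
    and f_def: "f = global_loss n f\<^sub>l" and primal: "\<Phi> = primal f"
    and smooth: "smooth_clients n f\<^sub>l L" and var: "bounded_variance n D f\<^sub>l G \<sigma>"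
    and het: "bounded_heterogeneity n f\<^sub>l \<zeta>\<^sub>x \<zeta>\<^sub>y" and PL: "PL_in_y f \<mu>"
    and bdd: "bdd_below (range \<Phi>)" and \<Delta>: "\<Phi> x0 - (INF x. \<Phi> x) \<le> \<Delta>\<^sub>\<Phi>" "\<Phi> x0 - f (x0, y0) \<le> \<Delta>\<^sub>y"
    and samples: "independent_samples n D M \<xi>"
    and hy: "hy > 0" "L * hy \<le> 1 / 4" and hx_eq: "hx = hy / (48 * (L / \<mu>)\<^sup>2)"
    and small: "6 * (real \<tau>)\<^sup>2 * hy\<^sup>2 * L\<^sup>2 \<le> 1"
    and T: "T \<ge> 1" and \<epsilon>: "\<epsilon> > 0"
    and budget: "\<bar>\<Delta>\<^sub>\<Phi>\<bar> + \<bar>\<Delta>\<^sub>y\<bar> + real T * (hy * L\<^sup>2 / 8 * ((real \<tau>)\<^sup>2 * (6 * hy\<^sup>2 * (\<sigma>\<^sup>2 + (\<zeta>\<^sub>x\<^sup>2 + \<zeta>\<^sub>y\<^sup>2))))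
      + L * hy\<^sup>2 / 2 * (\<sigma>\<^sup>2 / real n)) \<le> hx / 2 * (real T * \<epsilon>\<^sup>2)"
  shows "expected_stationary \<Phi> M
      (\<lambda>t \<omega>. avg_iterate n G hx hy \<tau> x0 y0 (\<lambda>k i. \<xi> k i \<omega>) t) T \<epsilon>"
proof -
  have grad: "GDERIV f z :> (1 / real n) *\<^sub>R (\<Sum>i<n. gradient (f\<^sub>l i) z)" for z
    unfolding f_def using smooth by (intro gradient_global_loss) (simp add: smooth_clients_def del: split_paired_All)
  then have F_avg: "gradient f z = (1 / real n) *\<^sub>R (\<Sum>i<n. gradient (f\<^sub>l i) z)" for z
    by (rule gradient_eqI)
  have Fi_lip: "norm (gradient (f\<^sub>l i) z - gradient (f\<^sub>l i) z') \<le> L * norm (z - z')" if "i < n" for i z z'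
    using smooth that by (simp add: smooth_clients_def del: split_paired_All)
  have lip: "norm (gradient f z - gradient f z') \<le> L * norm (z - z')" for z z'
  proof -
    have "norm (gradient f z - gradient f z')
        = norm (\<Sum>i<n. gradient (f\<^sub>l i) z - gradient (f\<^sub>l i) z') / real n"
      by (simp add: F_avg sum_subtractf flip: scaleR_diff_right)
    also have "\<dots> \<le> (\<Sum>i<n. L * norm (z - z')) / real n"
      using Fi_lip by (intro divide_right_mono sum_norm_le) auto
    also have "\<dots> = L * norm (z - z')" using \<open>n \<ge> 1\<close> by simp
    finally show ?thesis .
  qed
  have het: "(\<Sum>i<n. (norm (gradient (f\<^sub>l i) z - gradient f z))\<^sup>2) \<le> real n * (\<zeta>\<^sub>x\<^sup>2 + \<zeta>\<^sub>y\<^sup>2)" for z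
  proof -
    have "heterogeneity n f\<^sub>l fst z \<le> \<zeta>\<^sub>x\<^sup>2" "heterogeneity n f\<^sub>l snd z \<le> \<zeta>\<^sub>y\<^sup>2"
      using het by (auto simp: bounded_heterogeneity_def intro: cSUP_upper)
    then have "heterogeneity n f\<^sub>l fst z + heterogeneity n f\<^sub>l snd z \<le> \<zeta>\<^sub>x\<^sup>2 + \<zeta>\<^sub>y\<^sup>2" by linarith
    moreover have "(\<Sum>i<n. (norm (gradient (f\<^sub>l i) z - gradient f z))\<^sup>2)
        = real n * (heterogeneity n f\<^sub>l fst z + heterogeneity n f\<^sub>l snd z)"
      using \<open>n \<ge> 1\<close> by (simp add: heterogeneity_def f_def norm_prod_def sum.distrib distrib_left)
    ultimately show ?thesis by (simp add: mult_left_mono)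
  qed
  have "hy * 1 \<le> hy * (48 * (L / \<mu>)\<^sup>2)"
  proof -
    have "1 \<le> L / \<mu>" using \<open>\<mu> \<le> L\<close> \<open>\<mu> > 0\<close> by simp
    then have "1 \<le> (L / \<mu>)\<^sup>2" by (rule one_le_power)
    then show ?thesis using hy by (intro mult_left_mono) linarith+
  qed
  then have hx: "0 \<le> hx" "hx \<le> hy"
    using hy \<open>L > 0\<close> \<open>\<mu> > 0\<close> by (auto simp: hx_eq pos_divide_le_eq)
  interpret sgda_pl M n \<tau> D G "\<lambda>i. gradient (f\<^sub>l i)" "gradient f" \<xi> hx hy L \<sigma> "\<zeta>\<^sub>x\<^sup>2 + \<zeta>\<^sub>y\<^sup>2" x0 y0 f \<mu>
  proof (intro sgda_pl.intro sgda_run.intro sgda_run_axioms.intro pl_problem.intro)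
    show "prob_space M" using samples by (simp add: independent_samples_def)
    show "GDERIV f z :> gradient f z" for z unfolding F_avg by (rule grad)
  qed (use assms(1-5) hx samples var Fi_lip F_avg het lip PL in \<open>auto simp: bounded_variance_def\<close>)
  have \<Phi>_eq: "pl_problem.\<Phi> f = \<Phi>" by (simp add: primal \<Phi>_def)
  have lb: "(INF x. \<Phi> x) \<le> \<Phi> x" for x using bdd by (auto intro: cINF_lower)
  show ?thesis
  proof (rule sgda_expected_stationary[unfolded \<Phi>_eq \<kappa>_def S_def, OF hy hx_eq small _ lb T \<epsilon>])
    show "0 \<le> \<zeta>\<^sub>x\<^sup>2 + \<zeta>\<^sub>y\<^sup>2" by simp
    have "\<Phi> x0 - (INF x. \<Phi> x) + (\<Phi> x0 - f (x0, y0)) / 4 \<le> \<bar>\<Delta>\<^sub>\<Phi>\<bar> + \<bar>\<Delta>\<^sub>y\<bar>"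
    proof (rule add_mono)
      show "\<Phi> x0 - (INF x. \<Phi> x) \<le> \<bar>\<Delta>\<^sub>\<Phi>\<bar>" using \<Delta>(1) by linarith
      have "(\<Phi> x0 - f (x0, y0)) / 4 \<le> \<bar>\<Delta>\<^sub>y\<bar> / 4" using \<Delta>(2) by (intro divide_right_mono) auto
      then show "(\<Phi> x0 - f (x0, y0)) / 4 \<le> \<bar>\<Delta>\<^sub>y\<bar>" by (rule order_trans) simp
    qed
    with budget show "\<Phi> x0 - (INF x. \<Phi> x) + (\<Phi> x0 - f (x0, y0)) / 4
        + real T * (hy * L\<^sup>2 / 8 * ((real \<tau>)\<^sup>2 * (6 * hy\<^sup>2 * (\<sigma>\<^sup>2 + (\<zeta>\<^sub>x\<^sup>2 + \<zeta>\<^sub>y\<^sup>2))))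
        + L * hy\<^sup>2 / 2 * (\<sigma>\<^sup>2 / real n)) \<le> hx / 2 * (real T * \<epsilon>\<^sup>2)"
      by linarith
  qed
qed

section \<open>Choice of the parameters\<close>

lemma ceiling_bounds:
  fixes x :: real
  assumes "x > 0"
  shows "1 \<le> nat \<lceil>x\<rceil>" and "x \<le> real (nat \<lceil>x\<rceil>)" and "real (nat \<lceil>x\<rceil>) \<le> x + 1"
  using assms by linarith+

text \<open>Each smallness condition on \<open>h\<close> has one task: \<open>h1\<close> limits the
  step size, \<open>h2\<close> keeps the deviation recursion stable, \<open>h3\<close> pays for the
  averaged noise and \<open>h4\<close> for the deviation. \<open>A \<ge> a * n\<close> controls the
  rounding of \<open>\<tau>\<close>.\<close>

lemma sgda_parameters:
  fixes a h K L S V \<Delta> A :: real and n :: nat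
  assumes pos: "a > 0" "h > 0" "L > 0" "S \<ge> 0" "\<Delta> \<ge> 0" and n: "n \<ge> 1" and A: "A \<ge> a * real n"
    and h1: "4 * L * h \<le> a\<^sup>2" and h2: "3 * (L * (1 + 1 / a) * h) \<le> a"
    and h3: "144 * L * h * V \<le> 1" and h4: "216 * (L * (1 + 1 / a) * h)\<^sup>2 * S \<le> 1"
    and K: "K = 1 + 288 * \<Delta> / h"
    and hy: "hy = h * real n / A\<^sup>2" and \<tau>: "\<tau> = nat \<lceil>A / real n\<rceil>" and T: "T = nat \<lceil>K * (A ^ 4 / real n)\<rceil>"
  shows "hy > 0" and "\<tau> \<ge> 1" and "T \<ge> 1" and "L * hy \<le> 1 / 4"
    and "6 * (real \<tau>)\<^sup>2 * hy\<^sup>2 * L\<^sup>2 \<le> 1"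
    and "\<Delta> + real T * (hy * L\<^sup>2 / 8 * ((real \<tau>)\<^sup>2 * (6 * hy\<^sup>2 * S)) + L * hy\<^sup>2 / 2 * (V / real n))
      \<le> hy / (96 * A\<^sup>2) * real T"
    and "real T \<ge> A ^ 4 / real n" and "real T \<le> K * (A ^ 4 / real n) + 1"
    and "real_of_int (comm_rounds T \<tau>) \<le> K * A ^ 3 + 1 / a + 1"
proof -
  have n0: "real n > 0" and n1: "1 \<le> real n" using n by auto
  have an: "a * 1 \<le> a * real n" using pos n1 by (intro mult_left_mono) auto
  then have aA: "a \<le> A" and A0: "A > 0" using A pos by linarith+
  have K1: "K \<ge> 1" using pos by (simp add: K)
  show hy0: "hy > 0" using pos n0 A0 by (simp add: hy)
  have An: "a \<le> A / real n" using A n0 by (simp add: pos_le_divide_eq)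
  note t = ceiling_bounds[of "A / real n", folded \<tau>] ceiling_bounds[of "K * (A ^ 4 / real n)", folded T]
  show tau1: "\<tau> \<ge> 1" using t(1) A0 n0 by simp
  have KA: "0 < K * (A ^ 4 / real n)" using K1 A0 n0 by (intro mult_pos_pos) auto
  show T1: "T \<ge> 1" using t(4) KA by simp
  have T_ge: "K * (A ^ 4 / real n) \<le> real T" using t(5) KA by simp
  show T_le: "real T \<le> K * (A ^ 4 / real n) + 1" using t(6) KA by simp
  have "1 * (A ^ 4 / real n) \<le> K * (A ^ 4 / real n)" using K1 by (intro mult_right_mono) auto
  with T_ge show "real T \<ge> A ^ 4 / real n" by simp
  have A2: "a\<^sup>2 * real n \<le> A\<^sup>2"
  proof -
    have "a\<^sup>2 * real n \<le> a\<^sup>2 * (real n)\<^sup>2"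
      using n1 by (intro mult_left_mono) (auto simp: power2_eq_square)
    also have "\<dots> \<le> A\<^sup>2" using A pos n0 by (simp flip: power_mult_distrib) (simp add: power_mono)
    finally show ?thesis .
  qed
  show "L * hy \<le> 1 / 4"
  proof -
    have "4 * L * h * real n \<le> a\<^sup>2 * real n" using h1 by (intro mult_right_mono) auto
    with A2 have "4 * L * h * real n \<le> A\<^sup>2" by linarith
    then show ?thesis using A0 by (simp add: hy field_simps)
  qed
  \<comment> \<open>\<open>Q / A\<close> will bound \<open>\<tau> * hy * L\<close>; as
    \<open>A / n \<ge> a\<close>, rounding \<open>\<tau>\<close> up costs the factor
    \<open>1 + 1 / a\<close>.\<close>
  define Q where "Q = L * (1 + 1 / a) * h"
  have Q0: "Q > 0" using pos by (simp add: Q_def add_pos_pos)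
  have tau_le: "real \<tau> \<le> (1 + 1 / a) * (A / real n)"
  proof -
    have "1 = 1 / a * a" using pos by simp
    also have "\<dots> \<le> 1 / a * (A / real n)" using An pos by (intro mult_left_mono) auto
    finally have "real \<tau> \<le> A / real n + 1 / a * (A / real n)" using t(3) A0 n0 by fastforce
    then show ?thesis by (simp only: distrib_right mult_1_left)
  qed
  have tau_hy: "real \<tau> * hy * L \<le> Q / A"
  proof -
    have "real \<tau> * (hy * L) \<le> (1 + 1 / a) * (A / real n) * (hy * L)"
      using tau_le hy0 pos by (intro mult_right_mono) auto
    also have "\<dots> = Q / A" using A0 n0 by (simp add: Q_def hy power2_eq_square)
    finally show ?thesis by (simp add: mult.assoc)
  qed
  have tau_hy2: "(real \<tau>)\<^sup>2 * hy\<^sup>2 * L\<^sup>2 \<le> Q\<^sup>2 / A\<^sup>2"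
    using power_mono[OF tau_hy, of 2] hy0 pos by (simp add: power_mult_distrib power_divide)
  show "6 * (real \<tau>)\<^sup>2 * hy\<^sup>2 * L\<^sup>2 \<le> 1"
  proof -
    have "3 * Q \<le> A" using h2 aA by (simp add: Q_def)
    then have "(3 * Q)\<^sup>2 \<le> A\<^sup>2" using Q0 by (intro power_mono) auto
    then have "Q\<^sup>2 / A\<^sup>2 \<le> 1 / 9" using A0 by (simp add: power_mult_distrib field_simps)
    with tau_hy2 show ?thesis by simp
  qed
  \<comment> \<open>The available budget is \<open>E / 96\<close>, and each of three costs receives
    a third of it, hence 288. Then \<open>216 = 288 * 3/4\<close> and \<open>144 = 288 / 2\<close>
    are the constants in \<open>h4\<close> and \<open>h3\<close>.\<close>
  define E where "E = hy / A\<^sup>2 * real T"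
  have Thy: "0 \<le> real T * hy" using hy0 by simp
  have 1: "\<Delta> \<le> E / 288"
  proof -
    \<comment> \<open>\<open>K\<close> is chosen so that \<open>h * K = h + 288 * \<Delta>\<close>;
      all powers of \<open>A\<close> cancel in the product of \<open>hy / A\<^sup>2\<close> with the
      lower bound on \<open>T\<close>.\<close>
    have "288 * \<Delta> \<le> h * K" using pos by (simp add: K field_simps)
    also have "\<dots> = hy / A\<^sup>2 * (K * (A ^ 4 / real n))"
      using A0 n0 by (simp add: hy power2_eq_square power4_eq_xxxx)
    also have "\<dots> \<le> E" unfolding E_def using T_ge hy0 by (intro mult_left_mono) auto
    finally show ?thesis by simp
  qed
  have 2: "real T * (hy * L\<^sup>2 / 8 * ((real \<tau>)\<^sup>2 * (6 * hy\<^sup>2 * S))) \<le> E / 288"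
  proof -
    have "real T * (hy * L\<^sup>2 / 8 * ((real \<tau>)\<^sup>2 * (6 * hy\<^sup>2 * S)))
        = real T * hy * (3 / 4 * S * ((real \<tau>)\<^sup>2 * hy\<^sup>2 * L\<^sup>2))" by (simp add: algebra_simps)
    also have "\<dots> \<le> real T * hy * (3 / 4 * S * (Q\<^sup>2 / A\<^sup>2))"
      using tau_hy2 Thy pos by (intro mult_left_mono) auto
    also have "\<dots> = E * (216 * Q\<^sup>2 * S) / 288" by (simp add: E_def)
    also have "\<dots> \<le> E * 1 / 288"
      using h4 hy0 unfolding Q_def[symmetric]
      by (intro divide_right_mono mult_left_mono) (auto simp: E_def)
    finally show ?thesis by simp
  qed
  have 3: "real T * (L * hy\<^sup>2 / 2 * (V / real n)) \<le> E / 288"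
  proof -
    have "real T * (L * hy\<^sup>2 / 2 * (V / real n)) = real T * hy * (L * V / 2 * (hy / real n))"
      by (simp add: power2_eq_square)
    also have "hy / real n = h / A\<^sup>2" using n0 by (simp add: hy)
    also have "real T * hy * (L * V / 2 * (h / A\<^sup>2)) = E * (144 * L * h * V) / 288"
      by (simp add: E_def)
    also have "\<dots> \<le> E * 1 / 288"
      using h3 hy0 by (intro divide_right_mono mult_left_mono) (auto simp: E_def)
    finally show ?thesis by simp
  qed
  have "hy / (96 * A\<^sup>2) * real T = E / 96" by (simp add: E_def)
  with 1 2 3 show "\<Delta> + real T * (hy * L\<^sup>2 / 8 * ((real \<tau>)\<^sup>2 * (6 * hy\<^sup>2 * S)) + L * hy\<^sup>2 / 2 * (V / real n))
      \<le> hy / (96 * A\<^sup>2) * real T" unfolding distrib_left[of "real T"] by linarith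
  \<comment> \<open>Division by \<open>\<tau> \<ge> A / n\<close> turns \<open>A ^ 4 / n\<close>
    into \<open>A ^ 3\<close>, and the 1 from rounding \<open>T\<close> into
    \<open>n / A \<le> 1 / a\<close>.\<close>
  have "real T / real \<tau> \<le> (K * (A ^ 4 / real n) + 1) / (A / real n)"
    using T_le t(2) A0 n0 K1 by (intro frac_le) auto
  also have "\<dots> = K * A ^ 3 + real n / A"
    using A0 n0 by (simp add: field_simps power_numeral_reduce)
  also have "real n / A \<le> 1 / a" using A A0 pos by (simp add: field_simps)
  finally have "real T / real \<tau> \<le> K * A ^ 3 + 1 / a" by simp
  then show "real_of_int (comm_rounds T \<tau>) \<le> K * A ^ 3 + 1 / a + 1"
    unfolding comm_rounds_def by linarith
qed

theorem corollary1:
  fixes L\<^sub>f \<sigma> \<zeta>\<^sub>x \<zeta>\<^sub>y \<Delta>\<^sub>\<Phi> \<Delta>\<^sub>y c :: real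
  assumes "L\<^sub>f > 0" and "\<sigma> > 0" and "\<zeta>\<^sub>x \<ge> 0" and "\<zeta>\<^sub>y \<ge> 0" and "c > 0"
  shows "\<exists>C>0. \<forall>(n::nat) (\<mu>::real) (\<kappa>::real) (\<epsilon>::real).
    n \<ge> 1 \<and> \<mu> > 0 \<and> \<kappa> = L\<^sub>f / \<mu> \<and> \<kappa> \<ge> 1 \<and> \<epsilon> > 0 \<and> \<kappa> ^ 4 / (real n * \<epsilon> ^ 4) \<ge> c * real n ^ 3 \<longrightarrow>
    (\<exists>(\<eta>\<^sub>x::real) (\<eta>\<^sub>y::real) (\<tau>::nat) (T::nat).
       \<eta>\<^sub>x > 0 \<and> \<eta>\<^sub>y > 0 \<and> \<tau> \<ge> 1 \<and> T \<ge> 1 \<and>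
       real T \<ge> c * real n ^ 3 \<and>
       real T \<le> C * (\<kappa> ^ 4 / (real n * \<epsilon> ^ 4)) \<and>
       real_of_int (comm_rounds T \<tau>) \<le> C * (\<kappa> ^ 3 / \<epsilon> ^ 3) \<and>
       (\<forall>(D :: nat \<Rightarrow> 's measure)
          (L :: 'a::euclidean_space \<times> 'b::euclidean_space \<Rightarrow> 's \<Rightarrow> real)
          (G :: nat \<Rightarrow> 'a \<times> 'b \<Rightarrow> 's \<Rightarrow> 'a \<times> 'b)
          (M :: 'w measure) (\<xi> :: nat \<Rightarrow> nat \<Rightarrow> 'w \<Rightarrow> 's) (x\<^sub>0 :: 'a) (y\<^sub>0 :: 'b) f\<^sub>l f \<Phi>.
          f\<^sub>l = local_loss D L \<and> f = global_loss n f\<^sub>l \<and> \<Phi> = primal f \<and>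
          well_defined_loss n D L \<and>
          smooth_clients n f\<^sub>l L\<^sub>f \<and>
          bounded_variance n D f\<^sub>l G \<sigma> \<and>
          bounded_heterogeneity n f\<^sub>l \<zeta>\<^sub>x \<zeta>\<^sub>y \<and>
          PL_in_y f \<mu> \<and>
          bdd_below (range \<Phi>) \<and> \<Phi> x\<^sub>0 - (INF x. \<Phi> x) \<le> \<Delta>\<^sub>\<Phi> \<and> \<Phi> x\<^sub>0 - f (x\<^sub>0, y\<^sub>0) \<le> \<Delta>\<^sub>y \<and>
          independent_samples n D M \<xi> \<longrightarrow>
          expected_stationary \<Phi> M
            (\<lambda>t \<omega>. avg_iterate n G \<eta>\<^sub>x \<eta>\<^sub>y \<tau> x\<^sub>0 y\<^sub>0 (\<lambda>k i. \<xi> k i \<omega>) t) T \<epsilon>))"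
proof -
  \<comment> \<open>With \<open>A = \<kappa> / \<epsilon>\<close>, the fourth root turns the
    hypothesis \<open>A ^ 4 / n \<ge> c * n ^ 3\<close> into \<open>A \<ge> a * n\<close>.\<close>
  define a \<Delta> S where "a = root 4 c" and "\<Delta> = \<bar>\<Delta>\<^sub>\<Phi>\<bar> + \<bar>\<Delta>\<^sub>y\<bar>" and "S = \<sigma>\<^sup>2 + (\<zeta>\<^sub>x\<^sup>2 + \<zeta>\<^sub>y\<^sup>2)"
  have a: "a > 0" "a ^ 4 = c" using \<open>c > 0\<close> by (auto simp: a_def)
  have \<Delta>: "\<Delta> \<ge> 0" and S: "S \<ge> 0" by (auto simp: \<Delta>_def S_def)
  \<comment> \<open>One threshold per smallness condition; the reciprocal of their sum satisfies all
    four. In \<open>b4\<close>, 15 is used because \<open>15\<^sup>2 \<ge> 216\<close>, and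
    \<open>1 + S\<close> because \<open>S \<le> (1 + S)\<^sup>2\<close>, which makes the quadratic
    condition \<open>h4\<close> linear in \<open>h\<close>.\<close>
  define b1 b2 b3 b4 where "b1 = 4 * L\<^sub>f / a\<^sup>2" and "b2 = 3 * (L\<^sub>f * (1 + 1 / a)) / a"
    and "b3 = 144 * L\<^sub>f * \<sigma>\<^sup>2" and "b4 = 15 * (L\<^sub>f * (1 + 1 / a)) * (1 + S)"
  have b: "b1 > 0" "b2 > 0" "b3 > 0" "b4 > 0"
    using assms a S by (auto simp: b1_def b2_def b3_def b4_def add_pos_nonneg intro!: mult_pos_pos)
  define h where "h = 1 / (b1 + b2 + b3 + b4)"
  have h0: "h > 0" using b by (simp add: h_def)
  have hb: "b1 * h \<le> 1" "b2 * h \<le> 1" "b3 * h \<le> 1" "b4 * h \<le> 1"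
    using b by (auto simp: h_def)
  define K where "K = 1 + 288 * \<Delta> / h"
  have K1: "K \<ge> 1" using \<Delta> h0 by (simp add: K_def)
  have h1: "4 * L\<^sub>f * h \<le> a\<^sup>2" using hb(1) a by (simp add: b1_def field_simps)
  have h2: "3 * (L\<^sub>f * (1 + 1 / a) * h) \<le> a"
  proof -
    have "3 * (L\<^sub>f * (1 + 1 / a) * h) = a * (b2 * h)" using a by (simp add: b2_def)
    also have "\<dots> \<le> a * 1" using hb(2) a by (intro mult_left_mono) auto
    finally show ?thesis by simp
  qed
  have h3: "144 * L\<^sub>f * h * \<sigma>\<^sup>2 \<le> 1" using hb(3) by (simp add: b3_def mult_ac)
  have h4: "216 * (L\<^sub>f * (1 + 1 / a) * h)\<^sup>2 * S \<le> 1"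
  proof -
    define q where "q = L\<^sub>f * (1 + 1 / a) * h"
    have q: "15 * q * (1 + S) \<le> 1" using hb(4) by (simp add: b4_def q_def mult_ac)
    have q0: "0 \<le> q" using assms a h0 by (simp add: q_def)
    have "216 * q\<^sup>2 * S \<le> 225 * q\<^sup>2 * (1 + S)\<^sup>2"
    proof (rule mult_mono)
      show "S \<le> (1 + S)\<^sup>2" using S by (simp add: power2_eq_square algebra_simps)
    qed (use S in auto)
    also have "\<dots> = (15 * q * (1 + S))\<^sup>2" by (simp add: power_mult_distrib)
    also have "\<dots> \<le> 1" using q q0 S by (intro power_le_one) auto
    finally show ?thesis by (simp add: q_def)
  qed
  \<comment> \<open>The last two summands absorb additive constants: \<open>1 / c\<close> the 1 from
    rounding \<open>T\<close>, since \<open>A ^ 4 / n \<ge> c\<close>, and the other one the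
    \<open>1 / a + 1\<close> in the number of rounds, since \<open>A \<ge> a\<close>.\<close>
  define C where "C = K + 1 / c + (1 / a + 1) / a ^ 3"
  have parts: "0 < 1 / c" "0 < (1 / a + 1) / a ^ 3" using assms a by (auto simp: add_pos_pos)
  show ?thesis
  proof (rule exI[of _ C], intro conjI allI impI)
    show "C > 0" using K1 parts unfolding C_def by linarith
    fix n :: nat and \<mu> \<kappa> \<epsilon> :: real
    assume asm: "n \<ge> 1 \<and> \<mu> > 0 \<and> \<kappa> = L\<^sub>f / \<mu> \<and> \<kappa> \<ge> 1 \<and> \<epsilon> > 0 \<and> \<kappa> ^ 4 / (real n * \<epsilon> ^ 4) \<ge> c * real n ^ 3"
    then have n: "n \<ge> 1" and \<mu>: "\<mu> > 0" and \<kappa>: "\<kappa> = L\<^sub>f / \<mu>" "\<kappa> \<ge> 1" and \<epsilon>: "\<epsilon> > 0" by auto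
    define A where "A = \<kappa> / \<epsilon>"
    have A4: "\<kappa> ^ 4 / (real n * \<epsilon> ^ 4) = A ^ 4 / real n" and A3: "\<kappa> ^ 3 / \<epsilon> ^ 3 = A ^ 3"
      by (simp_all add: A_def power_divide)
    have A0: "A > 0" using \<kappa>(2) \<epsilon> by (simp add: A_def)
    have cn: "c * real n ^ 3 \<le> A ^ 4 / real n" using asm A4 by simp
    have "(a * real n) ^ 4 = c * real n ^ 3 * real n"
      unfolding power_mult_distrib a(2) by (simp add: power3_eq_cube power4_eq_xxxx)
    also have "\<dots> \<le> A ^ 4 / real n * real n" using cn by (intro mult_right_mono) auto
    also have "\<dots> = A ^ 4" using n by simp
    finally have "(a * real n) ^ 4 \<le> A ^ 4" .
    then have aA: "a * real n \<le> A" using A0 by (rule_tac power_le_imp_le_base[of _ 3]) simp_all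
    have "a * 1 \<le> a * real n" using a n by (intro mult_left_mono) auto
    with aA have "a \<le> A" by simp
    define hy \<tau> T where "hy = h * real n / A\<^sup>2" and "\<tau> = nat \<lceil>A / real n\<rceil>"
      and "T = nat \<lceil>K * (A ^ 4 / real n)\<rceil>"
    note p = sgda_parameters[OF a(1) h0 assms(1) S \<Delta> n aA h1 h2 h3 h4 K_def hy_def \<tau>_def T_def]
    define hx where "hx = hy / (48 * \<kappa>\<^sup>2)"
    have hx0: "hx > 0" using p(1) \<kappa>(2) by (simp add: hx_def)
    have "c * 1 \<le> c * real n ^ 3" using n assms by (intro mult_left_mono) (auto simp: one_le_power)
    then have c_le: "c \<le> A ^ 4 / real n" using cn by simp
    have "real T \<le> K * (A ^ 4 / real n) + 1" by (rule p(8))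
    also have "1 \<le> 1 / c * (A ^ 4 / real n)" using mult_left_mono[OF c_le, of "1 / c"] assms(5) by simp
    finally have "real T \<le> (K + 1 / c) * (A ^ 4 / real n)" by (simp only: distrib_right)
    also have "\<dots> \<le> C * (A ^ 4 / real n)"
      using parts n by (intro mult_right_mono) (auto simp: C_def)
    finally have T_le: "real T \<le> C * (A ^ 4 / real n)" .
    have "1 / a + 1 = (1 / a + 1) / a ^ 3 * a ^ 3" using a by simp
    also have "\<dots> \<le> (1 / a + 1) / a ^ 3 * A ^ 3"
      using \<open>a \<le> A\<close> a parts by (intro mult_left_mono power_mono) auto
    finally have "real_of_int (comm_rounds T \<tau>) \<le> (K + (1 / a + 1) / a ^ 3) * A ^ 3"
      using p(9) by (simp only: distrib_right)
    also have "\<dots> \<le> C * A ^ 3"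
      using parts A0 by (intro mult_right_mono) (auto simp: C_def)
    finally have comm: "real_of_int (comm_rounds T \<tau>) \<le> C * A ^ 3" .
    have \<mu>L: "\<mu> \<le> L\<^sub>f" using \<kappa> \<mu> by simp
    have "hx / 2 * (real T * \<epsilon>\<^sup>2) = hy / (96 * A\<^sup>2) * real T"
      using \<kappa>(2) \<epsilon> by (simp add: hx_def A_def power_divide)
    then have budget: "\<Delta> + real T * (hy * L\<^sub>f\<^sup>2 / 8 * ((real \<tau>)\<^sup>2 * (6 * hy\<^sup>2 * S))
        + L\<^sub>f * hy\<^sup>2 / 2 * (\<sigma>\<^sup>2 / real n)) \<le> hx / 2 * (real T * \<epsilon>\<^sup>2)"
      using p(6) by simp
    show "\<exists>(\<eta>\<^sub>x::real) (\<eta>\<^sub>y::real) (\<tau>::nat) (T::nat).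
       \<eta>\<^sub>x > 0 \<and> \<eta>\<^sub>y > 0 \<and> \<tau> \<ge> 1 \<and> T \<ge> 1 \<and>
       real T \<ge> c * real n ^ 3 \<and>
       real T \<le> C * (\<kappa> ^ 4 / (real n * \<epsilon> ^ 4)) \<and>
       real_of_int (comm_rounds T \<tau>) \<le> C * (\<kappa> ^ 3 / \<epsilon> ^ 3) \<and>
       (\<forall>(D :: nat \<Rightarrow> 's measure)
          (L :: 'a::euclidean_space \<times> 'b::euclidean_space \<Rightarrow> 's \<Rightarrow> real)
          (G :: nat \<Rightarrow> 'a \<times> 'b \<Rightarrow> 's \<Rightarrow> 'a \<times> 'b)
          (M :: 'w measure) (\<xi> :: nat \<Rightarrow> nat \<Rightarrow> 'w \<Rightarrow> 's) (x\<^sub>0 :: 'a) (y\<^sub>0 :: 'b) f\<^sub>l f \<Phi>.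
          f\<^sub>l = local_loss D L \<and> f = global_loss n f\<^sub>l \<and> \<Phi> = primal f \<and>
          well_defined_loss n D L \<and>
          smooth_clients n f\<^sub>l L\<^sub>f \<and>
          bounded_variance n D f\<^sub>l G \<sigma> \<and>
          bounded_heterogeneity n f\<^sub>l \<zeta>\<^sub>x \<zeta>\<^sub>y \<and>
          PL_in_y f \<mu> \<and>
          bdd_below (range \<Phi>) \<and> \<Phi> x\<^sub>0 - (INF x. \<Phi> x) \<le> \<Delta>\<^sub>\<Phi> \<and> \<Phi> x\<^sub>0 - f (x\<^sub>0, y\<^sub>0) \<le> \<Delta>\<^sub>y \<and>
          independent_samples n D M \<xi> \<longrightarrow>
          expected_stationary \<Phi> M
            (\<lambda>t \<omega>. avg_iterate n G \<eta>\<^sub>x \<eta>\<^sub>y \<tau> x\<^sub>0 y\<^sub>0 (\<lambda>k i. \<xi> k i \<omega>) t) T \<epsilon>)"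
      unfolding A4 A3
    proof (rule exI[of _ hx], rule exI[of _ hy], rule exI[of _ \<tau>], rule exI[of _ T], intro conjI allI impI)
      fix D :: "nat \<Rightarrow> 's measure" and L :: "'a \<times> 'b \<Rightarrow> 's \<Rightarrow> real" and G :: "nat \<Rightarrow> 'a \<times> 'b \<Rightarrow> 's \<Rightarrow> 'a \<times> 'b"
        and M :: "'w measure" and \<xi> :: "nat \<Rightarrow> nat \<Rightarrow> 'w \<Rightarrow> 's" and x\<^sub>0 y\<^sub>0 f\<^sub>l f \<Phi>
      assume "f\<^sub>l = local_loss D L \<and> f = global_loss n f\<^sub>l \<and> \<Phi> = primal f \<and>
          well_defined_loss n D L \<and>
          smooth_clients n f\<^sub>l L\<^sub>f \<and>
          bounded_variance n D f\<^sub>l G \<sigma> \<and>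
          bounded_heterogeneity n f\<^sub>l \<zeta>\<^sub>x \<zeta>\<^sub>y \<and>
          PL_in_y f \<mu> \<and>
          bdd_below (range \<Phi>) \<and> \<Phi> x\<^sub>0 - (INF x. \<Phi> x) \<le> \<Delta>\<^sub>\<Phi> \<and> \<Phi> x\<^sub>0 - f (x\<^sub>0, y\<^sub>0) \<le> \<Delta>\<^sub>y \<and>
          independent_samples n D M \<xi>"
      then have hyps: "f = global_loss n f\<^sub>l" "\<Phi> = primal f" "smooth_clients n f\<^sub>l L\<^sub>f"
        "bounded_variance n D f\<^sub>l G \<sigma>" "bounded_heterogeneity n f\<^sub>l \<zeta>\<^sub>x \<zeta>\<^sub>y" "PL_in_y f \<mu>"
        "bdd_below (range \<Phi>)" "\<Phi> x\<^sub>0 - (INF x. \<Phi> x) \<le> \<Delta>\<^sub>\<Phi>" "\<Phi> x\<^sub>0 - f (x\<^sub>0, y\<^sub>0) \<le> \<Delta>\<^sub>y"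
        "independent_samples n D M \<xi>"
        by - (elim conjE, assumption)+
      show "expected_stationary \<Phi> M
            (\<lambda>t \<omega>. avg_iterate n G hx hy \<tau> x\<^sub>0 y\<^sub>0 (\<lambda>k i. \<xi> k i \<omega>) t) T \<epsilon>"
        by (rule local_sgda_expected_stationary[OF n p(2) assms(1) \<mu> \<mu>L hyps p(1) p(4)
              hx_def[unfolded \<kappa>(1)] p(5) p(3) \<epsilon> budget[unfolded \<Delta>_def S_def]])
    next
      show "c * real n ^ 3 \<le> real T" using cn p(7) by linarith
    qed (rule hx0 p(1-3) T_le comm)+
  qed
qed

end
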